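(* Let $G=\langle s_1,\dots,s_r\rangle$ be a free group or free semigroup (with identity) of rank $r$, let $G\curvearrowright^T(X,\mathcal B,\mu)$ be a measure-preserving action, and let $\alpha$ be a partition of $X$ with $H(\alpha)<\infty$. Let $\beta$ be a partition of $X$ with $H(\beta)<\infty$ and $\beta^G\subset\alpha^G$. Then $$f_*(T,\alpha|\beta^G)=f(T,\alpha|\beta^G).$$
   Context: $G=\langle s_1,\dots,s_r\rangle$ is either a free group or a free semigroup with identity $e$ on $s_1,\dots,s_r$. Put $S=\{s_1^{\pm1},\dots,s_r^{\pm1}\}$ in the group case and $S=\{s_1,\dots,s_r\}$ in the semigroup case; $B(e,n)$ is the ball of radius $n$ about $e$ for the word metric of $S$. $G\curvearrowright^T(X,\mathcal B,\mu)$ means that $(X,\mathcal B,\mu)$ is a standard probability space and $g\mapsto T_g$ is a homomorphism from $G$ to the semigroup of measure-preserving transformations of $X$. Partitions are measurable and finite or countably infinite. $\alpha\vee\beta=\{A\cap B\}$; $H(\alpha)=-\sum_{A\in\alpha}\mu(A)\log\mu(A)$. For a sub-$\sigma$-algebra $\mathcal F$, $H(\alpha|\mathcal F)=\int_X -\log\big(\mu(A_x|\mathcal F)(x)\big)\,d\mu(x)$, where $A_x$ is the atom of $\alpha$ containing $x$ and $\mu(A|\mathcal F)$ is the conditional expectation of $\chi_A$. $\alpha^n=\bigvee_{g\in B(e,n)}T_g^{-1}\alpha$. $\alpha^G$ is the smallest $G$-invariant $\sigma$-algebra containing $\alpha$, where $\mathcal F$ is $G$-invariant if $T_g^{-1}A\in\mathcal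 F$ for all $A\in\mathcal F$, $g\in G$. For a $G$-invariant $\mathcal F$ and $s\in S$, $$h(T_s,\alpha|\mathcal F)=\lim_{n\to\infty}\frac1{n+1}H\Big(\bigvee_{i=0}^nT_s^{-i}\alpha\,\Big|\,\mathcal F\Big),$$ $$F(T,\alpha|\mathcal F)=(1-2r)H(\alpha|\mathcal F)+\sum_{i=1}^rH(\alpha\vee T_{s_i}^{-1}\alpha|\mathcal F),\qquad f(T,\alpha|\mathcal F)=\inf_{n>0}F(T,\alpha^n|\mathcal F),$$ $$F_*(T,\alpha|\mathcal F)=(1-r)H(\alpha|\mathcal F)+\sum_{i=1}^rh(T_{s_i},\alpha|\mathcal F),\qquad f_*(T,\alpha|\mathcal F)=\inf_{n>0}F_*(T,\alpha^n|\mathcal F).$$ *)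

theory Defs
  imports "HOL-Probability.Probability" "HOL-Algebra.Group"
begin

section \<open>Free groups and free semigroups with identity\<close>

definition word_prod :: "('g, 'b) monoid_scheme \<Rightarrow> 'g list \<Rightarrow> 'g" where
  "word_prod G w = foldr (mult G) w (one G)"

text \<open>The generators are \<open>s 1, \<dots>, s r\<close>. The letter \<open>(i, True)\<close> stands for \<open>s i\<close> and
  \<open>(i, False)\<close> for its inverse.\<close>

definition letter :: "('g, 'b) monoid_scheme \<Rightarrow> (nat \<Rightarrow> 'g) \<Rightarrow> nat \<times> bool \<Rightarrow> 'g" where
  "letter G s l = (if snd l then s (fst l) else m_inv G (s (fst l)))"

definition reduced_words :: "nat \<Rightarrow> (nat \<times> bool) list set" where
  "reduced_words r =
     {w. fst ` set w \<subseteq> {1..r} \<and> successively (\<lambda>k l. \<not> (fst k = fst l \<and> snd k \<noteq> snd l)) w}"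

text \<open>Freeness: every element is represented by exactly one reduced word (in the group case),
  respectively by exactly one word (in the semigroup case).\<close>

definition free_group_on :: "('g, 'b) monoid_scheme \<Rightarrow> nat \<Rightarrow> (nat \<Rightarrow> 'g) \<Rightarrow> bool" where
  "free_group_on G r s \<longleftrightarrow> group G \<and> s ` {1..r} \<subseteq> carrier G \<and>
     bij_betw (\<lambda>w. word_prod G (map (letter G s) w)) (reduced_words r) (carrier G)"

definition free_monoid_on :: "('g, 'b) monoid_scheme \<Rightarrow> nat \<Rightarrow> (nat \<Rightarrow> 'g) \<Rightarrow> bool" where
  "free_monoid_on G r s \<longleftrightarrow> monoid G \<and> s ` {1..r} \<subseteq> carrier G \<and>
     bij_betw (\<lambda>w. word_prod G (map s w)) (lists {1..r}) (carrier G)"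

text \<open>The ball about the identity: the elements of word length at most \<open>n\<close> with respect to \<open>S\<close>.\<close>

definition word_ball :: "('g, 'b) monoid_scheme \<Rightarrow> 'g set \<Rightarrow> nat \<Rightarrow> 'g set" where
  "word_ball G S n = {word_prod G w | w. set w \<subseteq> S \<and> length w \<le> n}"


section \<open>Measure-preserving actions\<close>

definition standard_borel :: "'a measure \<Rightarrow> bool" where
  "standard_borel M \<longleftrightarrow> (\<exists>X. topspace X = space M \<and> completely_metrizable_space X \<and>
     second_countable X \<and> sets M = sigma_sets (space M) {U. openin X U})"

text \<open>Both usual conventions are covered: the \<open>\<sigma>\<close>-algebra is either the Borel \<open>\<sigma>\<close>-algebra of a
  Polish space or its completion.\<close>

definition standard_prob_space :: "'a measure \<Rightarrow> bool" where
  "standard_prob_space M \<longleftrightarrow> prob_space M \<and>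
     (standard_borel M \<or> (\<exists>N. standard_borel N \<and> M = completion N))"

definition measure_preserving_map :: "'a measure \<Rightarrow> ('a \<Rightarrow> 'a) \<Rightarrow> bool" where
  "measure_preserving_map M t \<longleftrightarrow> t \<in> measurable M M \<and>
     (\<forall>A\<in>sets M. emeasure M (t -` A \<inter> space M) = emeasure M A)"

definition mp_action ::
  "('g, 'b) monoid_scheme \<Rightarrow> 'a measure \<Rightarrow> ('g \<Rightarrow> 'a \<Rightarrow> 'a) \<Rightarrow> bool" where
  "mp_action G M T \<longleftrightarrow>
     (\<forall>g\<in>carrier G. measure_preserving_map M (T g)) \<and>
     (\<forall>x\<in>space M. T (one G) x = x) \<and>
     (\<forall>g\<in>carrier G. \<forall>h\<in>carrier G. \<forall>x\<in>space M. T (mult G g h) x = T g (T h x))"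


section \<open>Partitions\<close>

text \<open>The empty set is allowed as a member, so that \<open>{A \<inter> B}\<close> is again a partition; it
  contributes nothing to the entropies.\<close>

definition meas_partition :: "'a measure \<Rightarrow> 'a set set \<Rightarrow> bool" where
  "meas_partition M \<alpha> \<longleftrightarrow> countable \<alpha> \<and> \<alpha> \<subseteq> sets M \<and> disjoint \<alpha> \<and> \<Union>\<alpha> = space M"

definition atom_of :: "'a set set \<Rightarrow> 'a \<Rightarrow> 'a set" where
  "atom_of \<alpha> x = (THE A. A \<in> \<alpha> \<and> x \<in> A)"

definition pullback :: "'a measure \<Rightarrow> ('a \<Rightarrow> 'a) \<Rightarrow> 'a set set \<Rightarrow> 'a set set" where
  "pullback M t \<alpha> = (\<lambda>A. t -` A \<inter> space M) ` \<alpha>"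

definition join :: "'a set set \<Rightarrow> 'a set set \<Rightarrow> 'a set set" where
  "join \<alpha> \<beta> = {A \<inter> B | A B. A \<in> \<alpha> \<and> B \<in> \<beta>}"

definition Join :: "'a measure \<Rightarrow> 'i set \<Rightarrow> ('i \<Rightarrow> 'a set set) \<Rightarrow> 'a set set" where
  "Join M I P = {space M \<inter> (\<Inter>i\<in>I. A i) | A. \<forall>i\<in>I. A i \<in> P i}"

definition ball_join ::
  "('g, 'b) monoid_scheme \<Rightarrow> 'g set \<Rightarrow> 'a measure \<Rightarrow> ('g \<Rightarrow> 'a \<Rightarrow> 'a) \<Rightarrow>
   'a set set \<Rightarrow> nat \<Rightarrow> 'a set set" where
  "ball_join G S M T \<alpha> n = Join M (word_ball G S n) (\<lambda>g. pullback M (T g) \<alpha>)"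

definition G_invariant ::
  "('g, 'b) monoid_scheme \<Rightarrow> 'a measure \<Rightarrow> ('g \<Rightarrow> 'a \<Rightarrow> 'a) \<Rightarrow> 'a set set \<Rightarrow> bool" where
  "G_invariant G M T \<F> \<longleftrightarrow> (\<forall>A\<in>\<F>. \<forall>g\<in>carrier G. T g -` A \<inter> space M \<in> \<F>)"

definition G_algebra ::
  "('g, 'b) monoid_scheme \<Rightarrow> 'a measure \<Rightarrow> ('g \<Rightarrow> 'a \<Rightarrow> 'a) \<Rightarrow> 'a set set \<Rightarrow> 'a set set" where
  "G_algebra G M T \<alpha> =
     \<Inter>{\<F>. sigma_algebra (space M) \<F> \<and> G_invariant G M T \<F> \<and> \<alpha> \<subseteq> \<F>}"


section \<open>Entropy\<close>

definition entropy_H :: "'a measure \<Rightarrow> 'a set set \<Rightarrow> ennreal" where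
  "entropy_H M \<alpha> = (\<Sum>\<^sub>\<infinity>A\<in>\<alpha>. ennreal (- (measure M A * ln (measure M A))))"

text \<open>Almost surely \<open>0 < \<mu>(A\<^sub>x|\<F>)(x) \<le> 1\<close>, so neither the value of \<open>ln\<close> at \<open>0\<close> nor the
  truncation performed by \<open>ennreal\<close> influences the integral.\<close>

definition cond_entropy_H :: "'a measure \<Rightarrow> 'a set set \<Rightarrow> 'a set set \<Rightarrow> ennreal" where
  "cond_entropy_H M \<alpha> \<F> =
     (\<integral>\<^sup>+x. ennreal (- ln (real_cond_exp M (sigma (space M) \<F>) (indicator (atom_of \<alpha> x)) x)) \<partial>M)"

definition entropy_rate ::
  "'a measure \<Rightarrow> ('a \<Rightarrow> 'a) \<Rightarrow> 'a set set \<Rightarrow> 'a set set \<Rightarrow> ennreal" where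
  "entropy_rate M t \<alpha> \<F> =
     lim (\<lambda>n. cond_entropy_H M (Join M {0..n} (\<lambda>i. pullback M (t ^^ i) \<alpha>)) \<F> / of_nat (n + 1))"

text \<open>\<open>F\<close> and \<open>F\<^sub>*\<close> are only meaningful for partitions of finite conditional entropy. The infima
  below can be \<open>-\<infinity>\<close>, whence \<open>ereal\<close>.\<close>

definition F_inv ::
  "nat \<Rightarrow> (nat \<Rightarrow> 'g) \<Rightarrow> 'a measure \<Rightarrow> ('g \<Rightarrow> 'a \<Rightarrow> 'a) \<Rightarrow> 'a set set \<Rightarrow> 'a set set \<Rightarrow> ereal" where
  "F_inv r s M T \<alpha> \<F> =
     ereal (1 - 2 * real r) * enn2ereal (cond_entropy_H M \<alpha> \<F>) +
     (\<Sum>i=1..r. enn2ereal (cond_entropy_H M (join \<alpha> (pullback M (T (s i)) \<alpha>)) \<F>))"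

definition F_star_inv ::
  "nat \<Rightarrow> (nat \<Rightarrow> 'g) \<Rightarrow> 'a measure \<Rightarrow> ('g \<Rightarrow> 'a \<Rightarrow> 'a) \<Rightarrow> 'a set set \<Rightarrow> 'a set set \<Rightarrow> ereal" where
  "F_star_inv r s M T \<alpha> \<F> =
     ereal (1 - real r) * enn2ereal (cond_entropy_H M \<alpha> \<F>) +
     (\<Sum>i=1..r. enn2ereal (entropy_rate M (T (s i)) \<alpha> \<F>))"

definition f_inv ::
  "('g, 'b) monoid_scheme \<Rightarrow> 'g set \<Rightarrow> nat \<Rightarrow> (nat \<Rightarrow> 'g) \<Rightarrow> 'a measure \<Rightarrow> ('g \<Rightarrow> 'a \<Rightarrow> 'a) \<Rightarrow>
   'a set set \<Rightarrow> 'a set set \<Rightarrow> ereal" where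
  "f_inv G S r s M T \<alpha> \<F> = (INF n\<in>{0<..}. F_inv r s M T (ball_join G S M T \<alpha> n) \<F>)"

definition f_star_inv ::
  "('g, 'b) monoid_scheme \<Rightarrow> 'g set \<Rightarrow> nat \<Rightarrow> (nat \<Rightarrow> 'g) \<Rightarrow> 'a measure \<Rightarrow> ('g \<Rightarrow> 'a \<Rightarrow> 'a) \<Rightarrow>
   'a set set \<Rightarrow> 'a set set \<Rightarrow> ereal" where
  "f_star_inv G S r s M T \<alpha> \<F> = (INF n\<in>{0<..}. F_star_inv r s M T (ball_join G S M T \<alpha> n) \<F>)"

end

theory Submission
  imports Defs
begin

text \<open>
  The proof rests on four properties of conditional entropy. For a finite set \<open>K\<close> of group elements let
  \<open>h K\<close> be the entropy, given the invariant \<open>\<sigma>\<close>-algebra \<open>\<F>\<close>, of the join of the partitions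
  \<open>T\<^sub>g\<^sup>-\<^sup>1 \<alpha>\<close> with \<open>g \<in> K\<close>, and let \<open>h(K | L) = h(K \<union> L) - h L\<close>. Then \<open>h\<close> is finite, monotone and
  submodular, and right translation by a generator satisfies \<open>h(K s | L s) \<le> h(K | L)\<close>. For an
  invertible action the last relation is an equality; for a semigroup action it holds because
  \<open>T\<^sub>s\<^sup>-\<^sup>1 \<F>\<close> is contained in \<open>\<F>\<close> and conditioning on more lowers entropy. Finiteness and the two
  inequalities come from a single one, \<open>cond_ent_submodular\<close>, in which submodularity and monotonicity in the
  conditioning algebra are proved together from \<open>ln t \<le> t - 1\<close>.

  The remaining argument is combinatorial and takes place in the locale \<open>shift_entropy\<close>. Write
  \<open>F K\<close> and \<open>F\<^sub>* K\<close> for the two functionals of the join over \<open>K\<close>; they differ in that \<open>F\<close> uses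
  \<open>h(K s | K)\<close> where \<open>F\<^sub>*\<close> uses the entropy rate \<open>rate s K\<close>.

  The rate is the limit of the averages of the decreasing increments
  \<open>h(K s\<^sup>n\<^sup>+\<^sup>1 | K \<union> \<dots> \<union> K s\<^sup>n)\<close>, the first of which is \<open>h(K s | K)\<close>. Hence \<open>F\<^sub>* \<le> F\<close>, which gives one
  inequality between the infima.

  For the other one, replace \<open>K\<close> by a long chain \<open>L = K \<union> K s \<union> \<dots> \<union> K s\<^sup>n\<close>. The term of \<open>s\<close> drops to
  \<open>rate s K\<close> up to \<open>\<epsilon>\<close>. The term of each of the other \<open>r - 1\<close> generators grows by at most \<open>h(L | K)\<close>,
  and the summand \<open>(1 - r) h\<close> falls by exactly \<open>(r - 1) h(L | K)\<close>. So the chain has replaced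
  \<open>h(K s | K)\<close> by \<open>rate s K\<close> at the cost of \<open>\<epsilon>\<close> (\<open>mixed_step\<close>). Treating all generators in turn yields
  a finite \<open>L \<supseteq> K\<close> with \<open>F L \<le> F\<^sub>* K + \<epsilon>\<close> (\<open>exists_F_near_Fstar\<close>).

  It remains to return from \<open>L\<close> to a ball. If \<open>x = k s\<close> or \<open>x s = k\<close> for some \<open>k \<in> K\<close> and some generator
  \<open>s\<close>, then \<open>F (K \<union> {x}) \<le> F K\<close> (\<open>F_insert_le\<close>). Since \<open>L\<close> contains the identity, a ball containing \<open>L\<close>
  is obtained from \<open>L\<close> by such steps, adding elements in order of word length, so its value of \<open>F\<close> is
  at most \<open>F L\<close>.
\<close>

section \<open>Atom maps and conditional probabilities\<close>

text \<open>A partition is represented by the map that sends a point to its atom. Joins become pointwise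
  intersections, which are commutative, associative and idempotent on the nose, whereas
  \<open>join\<close> and \<open>Join\<close> may differ by empty members.\<close>

definition atom_map :: "'a measure \<Rightarrow> ('a \<Rightarrow> 'a set) \<Rightarrow> bool" where
  "atom_map M a \<longleftrightarrow> countable (a ` space M) \<and>
     (\<forall>x\<in>space M. x \<in> a x \<and> a x \<in> sets M \<and> (\<forall>y\<in>a x. a y = a x))"

text \<open>The atom map of \<open>t\<^sup>-\<^sup>1 \<alpha>\<close>, if \<open>a\<close> is that of \<open>\<alpha>\<close>.\<close>

definition atom_pullback :: "'a measure \<Rightarrow> ('a \<Rightarrow> 'a) \<Rightarrow> ('a \<Rightarrow> 'a set) \<Rightarrow> 'a \<Rightarrow> 'a set" where
  "atom_pullback M t a x = t -` a (t x) \<inter> space M"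

text \<open>A version of the conditional probability of \<open>A\<close> that lies in \<open>[0, 1]\<close> everywhere and not
  just almost everywhere; this keeps the logarithms below free of sign conditions.\<close>

definition cond_prob :: "'a measure \<Rightarrow> 'a measure \<Rightarrow> 'a set \<Rightarrow> 'a \<Rightarrow> real" where
  "cond_prob M N A x = min 1 (max 0 (real_cond_exp M N (indicator A) x))"

text \<open>The entropy, given \<open>N\<close>, of the partition with atom map \<open>a\<close>.\<close>

definition cond_ent :: "'a measure \<Rightarrow> 'a measure \<Rightarrow> ('a \<Rightarrow> 'a set) \<Rightarrow> ennreal" where
  "cond_ent M N a = (\<integral>\<^sup>+x. ennreal (- ln (cond_prob M N (a x) x)) \<partial>M)"

lemma atom_mapD:
  assumes "atom_map M a" "x \<in> space M"
  shows "x \<in> a x" "a x \<in> sets M" "y \<in> a x \<Longrightarrow> a y = a x"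
  using assms unfolding atom_map_def by blast+

lemma atom_map_countable: "atom_map M a \<Longrightarrow> countable (a ` space M)"
  unfolding atom_map_def by (rule conjunct1)

lemma atom_map_range: "atom_map M a \<Longrightarrow> A \<in> a ` space M \<Longrightarrow> A \<in> sets M"
  by (elim imageE) (simp only: atom_mapD(2))

lemma atom_map_iff:
  assumes a: "atom_map M a" and x: "x \<in> space M" and A: "A \<in> a ` space M"
  shows "x \<in> A \<longleftrightarrow> a x = A"
  using A atom_mapD[OF a] x by (metis imageE)

lemma atom_map_measurable:
  assumes a: "atom_map M a"
  shows "a \<in> measurable M (count_space (a ` space M))"
proof -
  have "a -` {A} \<inter> space M = A" if "A \<in> a ` space M" for A
    using atom_map_iff[OF a _ that] sets.sets_into_space[OF atom_map_range[OF a that]] by auto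
  then have "\<And>A. A \<in> a ` space M \<Longrightarrow> a -` {A} \<inter> space M \<in> sets M"
    using atom_map_range[OF a] by simp
  then show ?thesis
    unfolding measurable_count_space_eq_countable[OF atom_map_countable[OF a]] by blast
qed

lemma measurable_atom_map_compose:
  assumes a: "atom_map M a" and f: "\<And>A. A \<in> a ` space M \<Longrightarrow> f A \<in> measurable M N"
  shows "(\<lambda>x. f (a x) x) \<in> measurable M N"
  by (rule measurable_compose_countable'[OF f atom_map_measurable[OF a] atom_map_countable[OF a]])

lemma AE_atom_map:
  assumes a: "atom_map M a" and P: "\<And>A. A \<in> a ` space M \<Longrightarrow> AE x in M. P A x"
  shows "AE x in M. P (a x) x"
proof -
  have "AE x in M. \<forall>A\<in>a ` space M. P A x"
    using P by (subst AE_ball_countable[OF atom_map_countable[OF a]]) auto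
  with AE_space show ?thesis by eventually_elim auto
qed

text \<open>The law of total expectation: on the atom \<open>A\<close> the integrand \<open>f (a x) x\<close> is \<open>f A x\<close>, and the
  countably many atoms cover the space.\<close>

lemma nn_integral_atoms:
  assumes a: "atom_map M a" and f: "\<And>A. A \<in> a ` space M \<Longrightarrow> f A \<in> borel_measurable M"
  shows "(\<integral>\<^sup>+x. f (a x) x \<partial>M) =
    (\<integral>\<^sup>+A. (\<integral>\<^sup>+x. f A x * indicator A x \<partial>M) \<partial>count_space (a ` space M))"
proof -
  have "f (a x) x = (\<integral>\<^sup>+A. f A x * indicator A x \<partial>count_space (a ` space M))" if x: "x \<in> space M" for x
  proof -
    have "(\<integral>\<^sup>+A. f A x * indicator A x \<partial>count_space (a ` space M)) = (\<Sum>A\<in>{a x}. f A x * indicator A x)"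
      using atom_map_iff[OF a x] x by (intro nn_integral_count_space') auto
    then show ?thesis using atom_mapD(1)[OF a x] by simp
  qed
  then have "(\<integral>\<^sup>+x. f (a x) x \<partial>M) = (\<integral>\<^sup>+x. (\<integral>\<^sup>+A. f A x * indicator A x \<partial>count_space (a ` space M)) \<partial>M)"
    by (intro nn_integral_cong) simp
  also have "\<dots> = (\<integral>\<^sup>+A. (\<integral>\<^sup>+x. f A x * indicator A x \<partial>M) \<partial>count_space (a ` space M))"
    using f atom_map_range[OF a]
    by (intro nn_integral_count_space_nn_integral[OF atom_map_countable[OF a]]
        borel_measurable_times_ennreal borel_measurable_indicator)
  finally show ?thesis .
qed

lemma atom_map_Int:
  assumes a: "atom_map M a" and b: "atom_map M b"
  shows "atom_map M (\<lambda>x. a x \<inter> b x)"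
  unfolding atom_map_def
proof (intro conjI ballI)
  have "(\<lambda>x. a x \<inter> b x) ` space M \<subseteq> (\<lambda>(A, B). A \<inter> B) ` (a ` space M \<times> b ` space M)"
    by auto
  then show "countable ((\<lambda>x. a x \<inter> b x) ` space M)"
    by (rule countable_subset) (use a b in \<open>simp add: atom_map_countable\<close>)
  fix x assume x: "x \<in> space M"
  show "x \<in> a x \<inter> b x" "a x \<inter> b x \<in> sets M"
    using x atom_mapD(1,2)[OF a] atom_mapD(1,2)[OF b] by auto
  fix y assume "y \<in> a x \<inter> b x"
  then have "a y = a x" "b y = b x"
    using atom_mapD(3)[OF a x] atom_mapD(3)[OF b x] by blast+
  then show "a y \<inter> b y = a x \<inter> b x" by simp
qed

lemma atom_map_space: "atom_map M (\<lambda>x. space M)"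
  by (auto simp: atom_map_def intro: countable_subset[of _ "{space M}"])

lemma atom_map_pullback:
  assumes a: "atom_map M a" and t: "t \<in> measurable M M"
  shows "atom_map M (atom_pullback M t a)"
  unfolding atom_map_def atom_pullback_def
proof (intro conjI ballI)
  have "(\<lambda>x. t -` a (t x) \<inter> space M) ` space M \<subseteq> (\<lambda>A. t -` A \<inter> space M) ` a ` space M"
    using measurable_space[OF t] by auto
  then show "countable ((\<lambda>x. t -` a (t x) \<inter> space M) ` space M)"
    by (rule countable_subset) (use a in \<open>simp add: atom_map_countable\<close>)
  fix x assume x: "x \<in> space M"
  then have tx: "t x \<in> space M" using measurable_space[OF t] by auto
  show "x \<in> t -` a (t x) \<inter> space M" using x atom_mapD(1)[OF a tx] by simp
  show "t -` a (t x) \<inter> space M \<in> sets M" using atom_mapD(2)[OF a tx] t by simp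
  fix y assume "y \<in> t -` a (t x) \<inter> space M"
  then show "t -` a (t y) \<inter> space M = t -` a (t x) \<inter> space M"
    using atom_mapD(3)[OF a tx, of "t y"] by simp
qed


lemma cond_prob_bounds [simp]: "0 \<le> cond_prob M N A x" "cond_prob M N A x \<le> 1"
  by (auto simp: cond_prob_def)

lemma cond_prob_measurable [measurable]: "cond_prob M N A \<in> borel_measurable N"
  unfolding cond_prob_def by measurable

lemma cond_prob_measurable' [measurable]: "cond_prob M N A \<in> borel_measurable M"
  unfolding cond_prob_def by measurable

context prob_space
begin

lemma subalgebra_finite:
  assumes "subalgebra M N"
  shows "finite_measure_subalgebra M N"
  using assms by unfold_locales auto

lemma cond_prob_AE:
  assumes N: "subalgebra M N" and A: "A \<in> sets M"
  shows "AE x in M. real_cond_exp M N (indicator A) x = cond_prob M N A x"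
    and "AE x in M. ennreal (cond_prob M N A x) = nn_cond_exp M N (indicator A) x"
proof -
  interpret finite_measure_subalgebra M N by (rule subalgebra_finite[OF N])
  have "AE x in M. nn_cond_exp M N (indicator A) x \<le> nn_cond_exp M N (\<lambda>_. 1) x"
    using A by (intro nn_cond_exp_mono) (auto split: split_indicator)
  moreover have "AE x in M. nn_cond_exp M N (\<lambda>_. 1) x = 1"
    using nn_cond_exp_F_meas[of "\<lambda>_. 1"] by simp
  moreover have "AE x in M. nn_cond_exp M N (\<lambda>_. 0) x = 0"
    using nn_cond_exp_F_meas[of "\<lambda>_. 0"] by simp
  ultimately have "AE x in M. real_cond_exp M N (indicator A) x = cond_prob M N A x \<and>
      ennreal (cond_prob M N A x) = nn_cond_exp M N (indicator A) x"
  proof eventually_elim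
    case (elim x)
    have pos: "(\<lambda>x. ennreal (indicator A x)) = indicator A"
      and neg: "(\<lambda>x. ennreal (- indicator A x)) = (\<lambda>_. 0)"
      by (auto simp: fun_eq_iff ennreal_neg split: split_indicator)
    obtain p where p: "0 \<le> p" "nn_cond_exp M N (indicator A) x = ennreal p"
      using elim by (cases "nn_cond_exp M N (indicator A) x") (auto simp: top_unique)
    then have "p \<le> 1" using elim by simp
    moreover have "real_cond_exp M N (indicator A) x = p"
      unfolding real_cond_exp_def pos neg using elim p by simp
    ultimately show ?case using p by (simp add: cond_prob_def)
  qed
  then show "AE x in M. real_cond_exp M N (indicator A) x = cond_prob M N A x"
    and "AE x in M. ennreal (cond_prob M N A x) = nn_cond_exp M N (indicator A) x"
    by auto
qed

text \<open>The defining property of conditional probability, for nonnegative integrands that need not be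
  integrable.\<close>

lemma nn_integral_cond_prob:
  assumes N: "subalgebra M N" and A: "A \<in> sets M" and f: "f \<in> borel_measurable N"
  shows "(\<integral>\<^sup>+x. f x * ennreal (cond_prob M N A x) \<partial>M) = (\<integral>\<^sup>+x. f x * indicator A x \<partial>M)"
proof -
  interpret finite_measure_subalgebra M N by (rule subalgebra_finite[OF N])
  have "(\<integral>\<^sup>+x. f x * ennreal (cond_prob M N A x) \<partial>M) = (\<integral>\<^sup>+x. f x * nn_cond_exp M N (indicator A) x \<partial>M)"
    using cond_prob_AE(2)[OF N A] by (intro nn_integral_cong_AE) auto
  also have "\<dots> = (\<integral>\<^sup>+x. f x * indicator A x \<partial>M)"
    using A f by (intro nn_cond_exp_intg) auto
  finally show ?thesis .
qed

text \<open>The part of \<open>A\<close> where the conditional probability of \<open>A\<close> vanishes is null: its measure is the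
  integral of that conditional probability over its zero set.\<close>

lemma cond_prob_pos:
  assumes N: "subalgebra M N" and A: "A \<in> sets M"
  shows "AE x in M. x \<in> A \<longrightarrow> 0 < cond_prob M N A x"
proof -
  let ?Z = "\<lambda>x. indicator {0} (cond_prob M N A x) :: ennreal"
  have [measurable]: "A \<in> sets M" by (rule A)
  have "(\<integral>\<^sup>+x. ?Z x * indicator A x \<partial>M) = (\<integral>\<^sup>+x. ?Z x * ennreal (cond_prob M N A x) \<partial>M)"
    by (rule nn_integral_cond_prob[OF N A, symmetric]) measurable
  also have "\<dots> = (\<integral>\<^sup>+x. 0 \<partial>M)"
    by (intro nn_integral_cong) (auto split: split_indicator)
  finally have "(\<integral>\<^sup>+x. ?Z x * indicator A x \<partial>M) = 0" by simp
  then have "AE x in M. ?Z x * indicator A x = 0"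
    by (subst (asm) nn_integral_0_iff_AE) auto
  then show ?thesis
    by eventually_elim (auto simp: less_le split: split_indicator_asm)
qed

lemma cond_prob_mono:
  assumes N: "subalgebra M N" and "A \<in> sets M" "B \<in> sets M" "A \<subseteq> B"
  shows "AE x in M. cond_prob M N A x \<le> cond_prob M N B x"
proof -
  interpret finite_measure_subalgebra M N by (rule subalgebra_finite[OF N])
  have "AE x in M. real_cond_exp M N (indicator A) x \<le> real_cond_exp M N (indicator B) x"
    using assms by (intro real_cond_exp_mono) (auto simp: integrable_indicator_iff less_top[symmetric] split: split_indicator)
  then show ?thesis
    by eventually_elim (auto simp: cond_prob_def)
qed

lemma cond_prob_space:
  assumes N: "subalgebra M N"
  shows "AE x in M. cond_prob M N (space M) x = 1"
proof -
  interpret finite_measure_subalgebra M N by (rule subalgebra_finite[OF N])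
  have "space M = space N" using N by (simp add: subalgebra_def)
  then have "indicator (space M) \<in> borel_measurable N"
    by (simp add: borel_measurable_indicator)
  then have "AE x in M. real_cond_exp M N (indicator (space M)) x = indicator (space M) x"
    by (intro real_cond_exp_F_meas) (simp_all add: integrable_indicator_iff less_top[symmetric])
  with AE_space show ?thesis
    by eventually_elim (simp add: cond_prob_def)
qed

lemma cond_prob_atom_measurable:
  "atom_map M a \<Longrightarrow> (\<lambda>x. cond_prob M N (a x) x) \<in> borel_measurable M"
  by (rule measurable_atom_map_compose) auto

lemma cond_prob_atom_pos:
  assumes N: "subalgebra M N" and a: "atom_map M a"
  shows "AE x in M. 0 < cond_prob M N (a x) x"
proof -
  have "AE x in M. x \<in> a x \<longrightarrow> 0 < cond_prob M N (a x) x"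
    using a by (rule AE_atom_map) (rule cond_prob_pos[OF N atom_map_range[OF a]])
  with AE_space show ?thesis by eventually_elim (use atom_mapD(1)[OF a] in auto)
qed

lemma cond_ent_space: "subalgebra M N \<Longrightarrow> cond_ent M N (\<lambda>x. space M) = 0"
proof -
  assume "subalgebra M N"
  from cond_prob_space[OF this] have "cond_ent M N (\<lambda>x. space M) = (\<integral>\<^sup>+x. 0 \<partial>M)"
    unfolding cond_ent_def by (intro nn_integral_cong_AE) (auto elim: eventually_mono)
  then show ?thesis by simp
qed

lemma cond_ent_mono:
  assumes N: "subalgebra M N" and a: "atom_map M a" and b: "atom_map M b"
    and ab: "\<And>x. x \<in> space M \<Longrightarrow> a x \<subseteq> b x"
  shows "cond_ent M N b \<le> cond_ent M N a"
proof -
  have "AE x in M. cond_prob M N (A \<inter> B) x \<le> cond_prob M N B x"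
    if "A \<in> a ` space M" "B \<in> b ` space M" for A B
    using that atom_map_range[OF a] atom_map_range[OF b] by (intro cond_prob_mono[OF N]) auto
  then have "AE x in M. cond_prob M N (A \<inter> b x) x \<le> cond_prob M N (b x) x" if "A \<in> a ` space M" for A
    using that by (intro AE_atom_map[OF b, of "\<lambda>B x. cond_prob M N (A \<inter> B) x \<le> cond_prob M N B x"])
  then have "AE x in M. cond_prob M N (a x \<inter> b x) x \<le> cond_prob M N (b x) x"
    by (rule AE_atom_map[OF a, of "\<lambda>A x. cond_prob M N (A \<inter> b x) x \<le> cond_prob M N (b x) x"])
  with AE_space cond_prob_atom_pos[OF N a]
  have "AE x in M. ennreal (- ln (cond_prob M N (b x) x)) \<le> ennreal (- ln (cond_prob M N (a x) x))"
  proof eventually_elim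
    case (elim x)
    then show ?case using ab[of x] by (intro ennreal_leI) (simp add: Int_absorb2)
  qed
  then show ?thesis unfolding cond_ent_def by (rule nn_integral_mono_AE)
qed


lemma cond_ent_cong: "(\<And>x. x \<in> space M \<Longrightarrow> a x = b x) \<Longrightarrow> cond_ent M N a = cond_ent M N b"
  unfolding cond_ent_def by (intro nn_integral_cong) simp

lemma entropy_integrand_measurable:
  "atom_map M a \<Longrightarrow> (\<lambda>x. ennreal (- ln (cond_prob M N (a x) x))) \<in> borel_measurable M"
  using cond_prob_atom_measurable[of a N] by measurable

text \<open>The integrand is a likelihood ratio: under the law that draws the \<open>c\<close>-atom \<open>C\<close> and the
  \<open>b\<close>-atom \<open>B\<close> as they are, but draws the \<open>a\<close>-atom \<open>A\<close> given \<open>C\<close> from \<open>N'\<close> alone, the triple has density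
  \<open>P(B \<inter> C | N) P(A \<inter> C | N') / P(C | N')\<close>, and the denominator is its true density. The total mass of a
  density is at most one. In the calculation the two densities are exchanged on each triple of atoms
  by \<open>nn_integral_cond_prob\<close>, and \<open>B\<close>, \<open>C\<close>, \<open>A\<close> are then summed out in this order.\<close>

lemma integral_likelihood_ratio:
  assumes N: "subalgebra M N" and NN': "subalgebra N N'"
    and a: "atom_map M a" and b: "atom_map M b" and c: "atom_map M c"
  shows "(\<integral>\<^sup>+x. ennreal (cond_prob M N (b x \<inter> c x) x * (cond_prob M N' (a x \<inter> c x) x / cond_prob M N' (c x) x)
      / cond_prob M N (a x \<inter> b x \<inter> c x) x) \<partial>M) \<le> 1"
proof -
  have N': "subalgebra M N'" using N NN' by (auto simp: subalgebra_def)
  let ?q = "\<lambda>A C x. cond_prob M N' (A \<inter> C) x / cond_prob M N' C x"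
  let ?R = "\<lambda>A B C x. ennreal (cond_prob M N (B \<inter> C) x * ?q A C x / cond_prob M N (A \<inter> B \<inter> C) x)"
  let ?a = "count_space (a ` space M)" and ?b = "count_space (b ` space M)" and ?c = "count_space (c ` space M)"
  have [measurable]: "A \<in> sets M" if "A \<in> a ` space M \<or> A \<in> b ` space M \<or> A \<in> c ` space M" for A
    using that atom_map_range a b c by blast
  have meas_q [measurable]: "?q A C \<in> borel_measurable N" "?q A C \<in> borel_measurable N'" "?q A C \<in> borel_measurable M" for A C
    by (auto intro!: borel_measurable_divide measurable_from_subalg[OF NN'])
  have bound: "(\<integral>\<^sup>+x. ?R A B C x * indicator A x * indicator C x * indicator B x \<partial>M) \<le>
      (\<integral>\<^sup>+x. ennreal (?q A C x) * indicator C x * indicator B x \<partial>M)"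
    if A: "A \<in> a ` space M" and B: "B \<in> b ` space M" and C: "C \<in> c ` space M" for A B C
  proof -
    have [measurable]: "A \<in> sets M" "B \<in> sets M" "C \<in> sets M"
      using atom_map_range[OF a A] atom_map_range[OF b B] atom_map_range[OF c C] .
    \<comment> \<open>the triple intersection is replaced by its conditional probability, which cancels the denominator\<close>
    have "(\<integral>\<^sup>+x. ?R A B C x * indicator A x * indicator C x * indicator B x \<partial>M) =
        (\<integral>\<^sup>+x. ?R A B C x * indicator (A \<inter> B \<inter> C) x \<partial>M)"
      by (intro nn_integral_cong) (auto split: split_indicator)
    also have "\<dots> = (\<integral>\<^sup>+x. ?R A B C x * ennreal (cond_prob M N (A \<inter> B \<inter> C) x) \<partial>M)"
      by (rule nn_integral_cond_prob[OF N, symmetric]) measurable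
    also have "\<dots> \<le> (\<integral>\<^sup>+x. ennreal (?q A C x) * ennreal (cond_prob M N (B \<inter> C) x) \<partial>M)"
      by (intro nn_integral_mono) (simp add: ennreal_mult'[symmetric] mult.commute)
    also have "\<dots> = (\<integral>\<^sup>+x. ennreal (?q A C x) * indicator (B \<inter> C) x \<partial>M)"
      by (rule nn_integral_cond_prob[OF N]) measurable
    also have "\<dots> = (\<integral>\<^sup>+x. ennreal (?q A C x) * indicator C x * indicator B x \<partial>M)"
      by (intro nn_integral_cong) (auto split: split_indicator)
    finally show ?thesis .
  qed
  have mR: "?R A B C \<in> borel_measurable M"
    if "A \<in> a ` space M" "B \<in> b ` space M" "C \<in> c ` space M" for A B C
    by measurable
  have mRb: "(\<lambda>x. ?R A (b x) C x) \<in> borel_measurable M"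
    if "A \<in> a ` space M" "C \<in> c ` space M" for A C
    by (rule measurable_atom_map_compose[OF b, of "\<lambda>B x. ?R A B C x"]) (rule mR[OF that(1) _ that(2)])
  have mRbc: "(\<lambda>x. ?R A (b x) (c x) x) \<in> borel_measurable M" if "A \<in> a ` space M" for A
    by (rule measurable_atom_map_compose[OF c, of "\<lambda>C x. ?R A (b x) C x"]) (rule mRb[OF that])
  have expand_b: "(\<integral>\<^sup>+x. ?R A (b x) C x * indicator A x * indicator C x \<partial>M) =
      (\<integral>\<^sup>+B. \<integral>\<^sup>+x. ?R A B C x * indicator A x * indicator C x * indicator B x \<partial>M \<partial>?b)"
    if A: "A \<in> a ` space M" and C: "C \<in> c ` space M" for A C
    using A C by (intro nn_integral_atoms[OF b, of "\<lambda>B x. ?R A B C x * indicator A x * indicator C x"]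
        borel_measurable_times_ennreal mR borel_measurable_indicator) auto
  have expand_c: "(\<integral>\<^sup>+x. ?R A (b x) (c x) x * indicator A x \<partial>M) =
      (\<integral>\<^sup>+C. \<integral>\<^sup>+x. ?R A (b x) C x * indicator A x * indicator C x \<partial>M \<partial>?c)"
    if A: "A \<in> a ` space M" for A
    using A by (intro nn_integral_atoms[OF c, of "\<lambda>C x. ?R A (b x) C x * indicator A x"]
        borel_measurable_times_ennreal mRb borel_measurable_indicator) auto
  have collapse_b: "(\<integral>\<^sup>+B. \<integral>\<^sup>+x. ennreal (?q A C x) * indicator C x * indicator B x \<partial>M \<partial>?b) =
      (\<integral>\<^sup>+x. ennreal (?q A C x) * indicator C x \<partial>M)" if C: "C \<in> c ` space M" for A C
    by (rule nn_integral_atoms[OF b, of "\<lambda>B x. ennreal (?q A C x) * indicator C x", symmetric])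
      (intro borel_measurable_times_ennreal borel_measurable_indicator
        measurable_compose[OF meas_q(3) measurable_ennreal] atom_map_range[OF c C])
  have collapse_c: "(\<integral>\<^sup>+C. \<integral>\<^sup>+x. indicator A x * indicator C x \<partial>M \<partial>?c) =
      (\<integral>\<^sup>+x. 1 * indicator A x \<partial>M)" if A: "A \<in> a ` space M" for A
    unfolding mult_1_left
    by (rule nn_integral_atoms[OF c, of "\<lambda>C x. indicator A x", symmetric])
      (intro borel_measurable_indicator atom_map_range[OF a A])
  have "(\<integral>\<^sup>+x. ?R (a x) (b x) (c x) x \<partial>M) =
      (\<integral>\<^sup>+A. \<integral>\<^sup>+x. ?R A (b x) (c x) x * indicator A x \<partial>M \<partial>?a)"
    by (rule nn_integral_atoms[OF a, of "\<lambda>A x. ?R A (b x) (c x) x"]) (rule mRbc)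
  also have "\<dots> = (\<integral>\<^sup>+A. \<integral>\<^sup>+C. \<integral>\<^sup>+B. \<integral>\<^sup>+x. ?R A B C x * indicator A x * indicator C x * indicator B x \<partial>M \<partial>?b \<partial>?c \<partial>?a)"
    by (rule nn_integral_cong, rule trans[OF expand_c nn_integral_cong[OF expand_b]]) simp_all
  also have "\<dots> \<le> (\<integral>\<^sup>+A. \<integral>\<^sup>+C. \<integral>\<^sup>+B. \<integral>\<^sup>+x. ennreal (?q A C x) * indicator C x * indicator B x \<partial>M \<partial>?b \<partial>?c \<partial>?a)"
    by (rule nn_integral_mono, rule nn_integral_mono, rule nn_integral_mono, rule bound) simp_all
  also have "\<dots> = (\<integral>\<^sup>+A. \<integral>\<^sup>+C. \<integral>\<^sup>+x. ennreal (?q A C x) * indicator C x \<partial>M \<partial>?c \<partial>?a)"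
    by (rule nn_integral_cong, rule nn_integral_cong, rule collapse_b) simp
  also have "\<dots> \<le> (\<integral>\<^sup>+A. \<integral>\<^sup>+C. \<integral>\<^sup>+x. indicator A x * indicator C x \<partial>M \<partial>?c \<partial>?a)"
  proof (rule nn_integral_mono, rule nn_integral_mono)
    fix A C assume "A \<in> space ?a" "C \<in> space ?c"
    then have [measurable]: "A \<in> sets M" "C \<in> sets M"
      using atom_map_range[OF a, of A] atom_map_range[OF c, of C] by auto
    have "(\<integral>\<^sup>+x. ennreal (?q A C x) * indicator C x \<partial>M) = (\<integral>\<^sup>+x. ennreal (?q A C x) * ennreal (cond_prob M N' C x) \<partial>M)"
      by (rule nn_integral_cond_prob[OF N', symmetric]) measurable
    also have "\<dots> \<le> (\<integral>\<^sup>+x. 1 * ennreal (cond_prob M N' (A \<inter> C) x) \<partial>M)"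
      by (intro nn_integral_mono) (simp add: ennreal_mult'[symmetric])
    also have "\<dots> = (\<integral>\<^sup>+x. 1 * indicator (A \<inter> C) x \<partial>M)"
      by (rule nn_integral_cond_prob[OF N']) measurable
    finally show "(\<integral>\<^sup>+x. ennreal (?q A C x) * indicator C x \<partial>M) \<le> (\<integral>\<^sup>+x. indicator A x * indicator C x \<partial>M)"
      by (simp add: indicator_inter_arith)
  qed
  also have "\<dots> = (\<integral>\<^sup>+A. \<integral>\<^sup>+x. 1 * indicator A x \<partial>M \<partial>?a)"
    by (rule nn_integral_cong, rule collapse_c) simp
  also have "\<dots> = (\<integral>\<^sup>+x. 1 \<partial>M)"
    by (rule nn_integral_atoms[OF a, of "\<lambda>A x. 1", symmetric]) measurable
  finally show ?thesis by (simp add: emeasure_space_1)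
qed

text \<open>In terms of conditional entropies this reads \<open>H(a | b \<or> c \<or> N) \<le> H(a | c \<or> N')\<close>: conditioning on more
  lowers entropy, where both the partition and the \<open>\<sigma>\<close>-algebra may grow. It is written without
  subtractions, so that it holds in the extended nonnegative reals. The case \<open>N = N'\<close> is
  submodularity. The proof applies \<open>ln t \<le> t - 1\<close> to the likelihood ratio above.\<close>

lemma cond_ent_submodular:
  assumes N: "subalgebra M N" and NN': "subalgebra N N'"
    and a: "atom_map M a" and b: "atom_map M b" and c: "atom_map M c"
  shows "cond_ent M N (\<lambda>x. a x \<inter> b x \<inter> c x) + cond_ent M N' c \<le>
    cond_ent M N (\<lambda>x. b x \<inter> c x) + cond_ent M N' (\<lambda>x. a x \<inter> c x)"
proof -
  have N': "subalgebra M N'" using N NN' by (auto simp: subalgebra_def)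
  note bc = atom_map_Int[OF b c] and ac = atom_map_Int[OF a c]
    and abc = atom_map_Int[OF atom_map_Int[OF a b] c]
  let ?H = "\<lambda>N a x. ennreal (- ln (cond_prob M N (a x) x))"
  let ?R = "\<lambda>x. ennreal (cond_prob M N (b x \<inter> c x) x * (cond_prob M N' (a x \<inter> c x) x / cond_prob M N' (c x) x)
      / cond_prob M N (a x \<inter> b x \<inter> c x) x)"
  note [measurable] = cond_prob_atom_measurable[OF bc] cond_prob_atom_measurable[OF ac]
    cond_prob_atom_measurable[OF abc] cond_prob_atom_measurable[OF c]
  have "AE x in M. ?H N (\<lambda>x. a x \<inter> b x \<inter> c x) x + ?H N' c x + 1 \<le>
      ?H N (\<lambda>x. b x \<inter> c x) x + ?H N' (\<lambda>x. a x \<inter> c x) x + ?R x"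
    using cond_prob_atom_pos[OF N bc] cond_prob_atom_pos[OF N' ac] cond_prob_atom_pos[OF N abc] cond_prob_atom_pos[OF N' c]
  proof eventually_elim
    case (elim x)
    define u where "u = cond_prob M N (a x \<inter> b x \<inter> c x) x"
    define v where "v = cond_prob M N (b x \<inter> c x) x"
    define w where "w = cond_prob M N' (a x \<inter> c x) x"
    define z where "z = cond_prob M N' (c x) x"
    have pos: "0 < u" "0 < v" "0 < w" "0 < z" and le: "u \<le> 1" "v \<le> 1" "w \<le> 1" "z \<le> 1"
      using elim by (simp_all add: u_def v_def w_def z_def)
    have "ln (v * (w / z) / u) = ln v + ln w - ln z - ln u"
      using pos by (simp add: ln_mult ln_div)
    moreover have "ln (v * (w / z) / u) \<le> v * (w / z) / u - 1"
      using pos by (intro ln_le_minus_one) simp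
    ultimately have "- ln u + - ln z + 1 \<le> - ln v + - ln w + v * (w / z) / u" by simp
    then have "ennreal (- ln u + - ln z + 1) \<le> ennreal (- ln v + - ln w + v * (w / z) / u)"
      by (rule ennreal_leI)
    moreover have nonneg: "0 \<le> - ln u" "0 \<le> - ln v" "0 \<le> - ln w" "0 \<le> - ln z" "0 \<le> v * (w / z) / u"
      using pos le by simp_all
    then have "ennreal (- ln u + - ln z + 1) = ennreal (- ln u) + ennreal (- ln z) + 1"
      by (metis add_nonneg_nonneg ennreal_1 ennreal_plus zero_le_one)
    moreover have "ennreal (- ln v + - ln w + v * (w / z) / u) =
        ennreal (- ln v) + ennreal (- ln w) + ennreal (v * (w / z) / u)"
      using nonneg by (metis add_nonneg_nonneg ennreal_plus)
    ultimately have "ennreal (- ln u) + ennreal (- ln z) + 1 \<le>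
        ennreal (- ln v) + ennreal (- ln w) + ennreal (v * (w / z) / u)"
      by simp
    then show ?case by (simp add: u_def v_def w_def z_def)
  qed
  then have "(\<integral>\<^sup>+x. ?H N (\<lambda>x. a x \<inter> b x \<inter> c x) x + ?H N' c x + 1 \<partial>M) \<le>
      (\<integral>\<^sup>+x. ?H N (\<lambda>x. b x \<inter> c x) x + ?H N' (\<lambda>x. a x \<inter> c x) x + ?R x \<partial>M)"
    by (rule nn_integral_mono_AE)
  then have "cond_ent M N (\<lambda>x. a x \<inter> b x \<inter> c x) + cond_ent M N' c + 1 \<le>
      cond_ent M N (\<lambda>x. b x \<inter> c x) + cond_ent M N' (\<lambda>x. a x \<inter> c x) + (\<integral>\<^sup>+x. ?R x \<partial>M)"
    unfolding cond_ent_def by (simp add: nn_integral_add emeasure_space_1)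
  also have "\<dots> \<le> cond_ent M N (\<lambda>x. b x \<inter> c x) + cond_ent M N' (\<lambda>x. a x \<inter> c x) + 1"
    by (intro add_left_mono integral_likelihood_ratio[OF N NN' a b c])
  finally show ?thesis
    by (simp add: add.commute[of _ 1] ennreal_add_left_cancel_le)
qed


lemma cond_ent_le_subalgebra:
  assumes N: "subalgebra M N" and NN': "subalgebra N N'" and a: "atom_map M a"
  shows "cond_ent M N a \<le> cond_ent M N' a"
proof -
  have N': "subalgebra M N'" using N NN' by (auto simp: subalgebra_def)
  have cong: "cond_ent M K (\<lambda>x. a x \<inter> space M \<inter> space M) = cond_ent M K a" "cond_ent M K (\<lambda>x. a x \<inter> space M) = cond_ent M K a" for K
    by (intro cond_ent_cong; use atom_mapD(2)[OF a] sets.sets_into_space in blast)+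
  from cond_ent_submodular[OF N NN' a atom_map_space atom_map_space] show ?thesis
    by (simp add: cong cond_ent_space N N')
qed

text \<open>Static entropy is entropy given the trivial \<open>\<sigma>\<close>-algebra, which is generated by no sets.\<close>

lemma cond_prob_trivial:
  assumes A: "A \<in> sets M"
  shows "AE x in M. cond_prob M (sigma (space M) {}) A x = measure M A"
proof -
  let ?N = "sigma (space M) {}"
  have sets: "sets ?N = {{}, space M}"
    by (simp add: sigma_sets_empty_eq)
  then have N: "subalgebra M ?N" by (auto simp: subalgebra_def)
  interpret finite_measure_subalgebra M ?N by (rule subalgebra_finite[OF N])
  have "AE x in M. real_cond_exp M ?N (indicator A) x = measure M A"
  proof (rule real_cond_exp_charact)
    fix E assume "E \<in> sets ?N"
    then have "E = {} \<or> E = space M" unfolding sets by simp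
    then show "(LINT x:E|M. indicator A x) = (LINT x:E|M. measure M A)"
      using A by (auto simp: set_lebesgue_integral_def indicator_inter_arith[symmetric]
          prob_space sets.Int_space_eq1 cong: Bochner_Integration.integral_cong)
  qed (use A in \<open>auto simp: integrable_indicator_iff less_top[symmetric]\<close>)
  then show ?thesis
    by eventually_elim (simp add: cond_prob_def)
qed

lemma cond_ent_trivial:
  assumes a: "atom_map M a"
  shows "cond_ent M (sigma (space M) {}) a =
    (\<integral>\<^sup>+A. ennreal (- (measure M A * ln (measure M A))) \<partial>count_space (a ` space M))"
proof -
  have "AE x in M. cond_prob M (sigma (space M) {}) (a x) x = measure M (a x)"
    by (rule AE_atom_map[OF a, of "\<lambda>A x. cond_prob M (sigma (space M) {}) A x = measure M A"])
      (rule cond_prob_trivial[OF atom_map_range[OF a]])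
  then have "cond_ent M (sigma (space M) {}) a = (\<integral>\<^sup>+x. ennreal (- ln (measure M (a x))) \<partial>M)"
    unfolding cond_ent_def by (intro nn_integral_cong_AE) (auto elim: eventually_mono)
  also have "\<dots> = (\<integral>\<^sup>+A. (\<integral>\<^sup>+x. ennreal (- ln (measure M A)) * indicator A x \<partial>M) \<partial>count_space (a ` space M))"
    by (rule nn_integral_atoms[OF a, of "\<lambda>A x. ennreal (- ln (measure M A))"]) simp
  also have "\<dots> = (\<integral>\<^sup>+A. ennreal (- (measure M A * ln (measure M A))) \<partial>count_space (a ` space M))"
  proof (rule nn_integral_cong)
    fix A assume "A \<in> space (count_space (a ` space M))"
    then have A: "A \<in> sets M" using atom_map_range[OF a] by simp
    have "ennreal (- ln (measure M A)) * ennreal (measure M A) = ennreal (- (measure M A * ln (measure M A)))"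
      by (subst ennreal_mult''[symmetric]) (simp_all add: mult.commute)
    then show "(\<integral>\<^sup>+x. ennreal (- ln (measure M A)) * indicator A x \<partial>M) = ennreal (- (measure M A * ln (measure M A)))"
      using A by (simp add: nn_integral_cmult_indicator emeasure_eq_measure)
  qed
  finally show ?thesis .
qed

lemma distr_measure_preserving:
  assumes "measure_preserving_map M t"
  shows "distr M M t = M"
  using assms unfolding measure_preserving_map_def
  by (intro measure_eqI) (auto simp: emeasure_distr)

text \<open>The conditional probability of \<open>t\<^sup>-\<^sup>1 A\<close> given \<open>t\<^sup>-\<^sup>1 N\<close> is that of \<open>A\<close> given \<open>N\<close>, evaluated at the image
  point.\<close>

lemma cond_prob_pullback:
  assumes t: "measure_preserving_map M t" and N: "subalgebra M N"
    and tN: "t \<in> measurable N N" and A: "A \<in> sets M"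
  shows "AE x in M. cond_prob M (vimage_algebra (space M) t N) (t -` A \<inter> space M) x = cond_prob M N A (t x)"
proof -
  let ?N = "vimage_algebra (space M) t N"
  have tM [measurable]: "t \<in> measurable M M" using t by (simp add: measure_preserving_map_def)
  have [measurable]: "A \<in> sets M" by (rule A)
  have sp: "space N = space M" using N by (simp add: subalgebra_def)
  have tsp: "t \<in> space M \<rightarrow> space N" using measurable_space[OF tM] sp by auto
  have sets: "sets ?N = {t -` E \<inter> space M | E. E \<in> sets N}"
    by (rule sets_vimage_algebra2[OF tsp])
  have N': "subalgebra M ?N"
    unfolding subalgebra_def sets using N tM by (auto simp: subalgebra_def)
  have distr: "(LINT x|M. f (t x)) = (LINT x|M. f x)" if "f \<in> borel_measurable M" for f :: "'a \<Rightarrow> real"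
    using integral_distr[OF tM that] distr_measure_preserving[OF t] by simp
  interpret N': finite_measure_subalgebra M ?N by (rule subalgebra_finite[OF N'])
  interpret finite_measure_subalgebra M N by (rule subalgebra_finite[OF N])
  have int: "integrable M (indicator A :: 'a \<Rightarrow> real)"
    by (simp add: integrable_indicator_iff less_top[symmetric])
  let ?p = "real_cond_exp M N (indicator A)"
  have "AE x in M. real_cond_exp M ?N (indicator (t -` A \<inter> space M)) x = ?p (t x)"
  proof (rule N'.real_cond_exp_charact)
    fix E assume "E \<in> sets ?N"
    then obtain E' where E': "E' \<in> sets N" "E = t -` E' \<inter> space M" unfolding sets by auto
    then have [measurable]: "E' \<in> sets M" using N by (auto simp: subalgebra_def)
    have "(LINT x:E|M. indicator (t -` A \<inter> space M) x) = (LINT x|M. (\<lambda>y. indicator E' y *\<^sub>R indicator A y) (t x) :: real)"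
      unfolding set_lebesgue_integral_def E'
      by (intro Bochner_Integration.integral_cong) (auto split: split_indicator)
    also have "\<dots> = (LINT x:E'|M. indicator A x)"
      unfolding set_lebesgue_integral_def by (rule distr) measurable
    also have "\<dots> = (LINT x:E'|M. ?p x)"
      by (rule real_cond_exp_intA[OF int E'(1)])
    also have "\<dots> = (LINT x|M. (\<lambda>y. indicator E' y *\<^sub>R ?p y) (t x))"
      unfolding set_lebesgue_integral_def by (rule distr[symmetric]) measurable
    also have "\<dots> = (LINT x:E|M. ?p (t x))"
      unfolding set_lebesgue_integral_def E'
      by (intro Bochner_Integration.integral_cong) (auto split: split_indicator)
    finally show "(LINT x:E|M. indicator (t -` A \<inter> space M) x) = (LINT x:E|M. ?p (t x))" .
  next
    show "integrable M (indicator (t -` A \<inter> space M) :: 'a \<Rightarrow> real)"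
      by (simp add: integrable_indicator_iff less_top[symmetric])
    show "integrable M (\<lambda>x. ?p (t x))"
      using real_cond_exp_int(1)[OF int] integrable_distr_eq[OF tM, of ?p] distr_measure_preserving[OF t] by simp
    show "(\<lambda>x. ?p (t x)) \<in> borel_measurable ?N"
      using measurable_vimage_algebra1[OF tsp] by (rule measurable_compose) simp
  qed
  then show ?thesis
    by eventually_elim (simp add: cond_prob_def)
qed

lemma cond_ent_pullback:
  assumes t: "measure_preserving_map M t" and N: "subalgebra M N"
    and tN: "t \<in> measurable N N" and a: "atom_map M a"
  shows "cond_ent M (vimage_algebra (space M) t N) (atom_pullback M t a) = cond_ent M N a"
proof -
  let ?N = "vimage_algebra (space M) t N"
  have tM [measurable]: "t \<in> measurable M M" using t by (simp add: measure_preserving_map_def)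
  have "AE x in M. \<forall>A\<in>a ` space M. cond_prob M ?N (t -` A \<inter> space M) x = cond_prob M N A (t x)"
    using cond_prob_pullback[OF t N tN atom_map_range[OF a]]
    by (subst AE_ball_countable[OF atom_map_countable[OF a]]) blast
  with AE_space have "AE x in M. cond_prob M ?N (atom_pullback M t a x) x = cond_prob M N (a (t x)) (t x)"
    by eventually_elim (use measurable_space[OF tM] in \<open>auto simp: atom_pullback_def\<close>)
  then have "cond_ent M ?N (atom_pullback M t a) = (\<integral>\<^sup>+x. ennreal (- ln (cond_prob M N (a (t x)) (t x))) \<partial>M)"
    unfolding cond_ent_def by (intro nn_integral_cong_AE) (auto elim: eventually_mono)
  also have "\<dots> = (\<integral>\<^sup>+y. ennreal (- ln (cond_prob M N (a y) y)) \<partial>distr M M t)"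
    using entropy_integrand_measurable[OF a] by (intro nn_integral_distr[OF tM, symmetric]) simp
  finally show ?thesis
    unfolding distr_measure_preserving[OF t] cond_ent_def .
qed

text \<open>This is \<open>H(t\<^sup>-\<^sup>1 a | t\<^sup>-\<^sup>1 c \<or> N) \<le> H(a | c \<or> N)\<close>. The right-hand side equals
  \<open>H(t\<^sup>-\<^sup>1 a | t\<^sup>-\<^sup>1 c \<or> t\<^sup>-\<^sup>1 N)\<close> because \<open>t\<close> preserves the measure, and \<open>t\<^sup>-\<^sup>1 N\<close> is contained in \<open>N\<close>. For
  noninvertible \<open>t\<close> the inclusion can be proper, which is why only an inequality is available.\<close>

lemma cond_ent_pullback_submodular:
  assumes t: "measure_preserving_map M t" and N: "subalgebra M N"
    and tN: "t \<in> measurable N N" and a: "atom_map M a" and c: "atom_map M c"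
  shows "cond_ent M N (atom_pullback M t (\<lambda>x. a x \<inter> c x)) + cond_ent M N c \<le>
    cond_ent M N (atom_pullback M t c) + cond_ent M N (\<lambda>x. a x \<inter> c x)"
proof -
  let ?N = "vimage_algebra (space M) t N" and ?p = "atom_pullback M t"
  have tM: "t \<in> measurable M M" using t by (simp add: measure_preserving_map_def)
  have sp: "space N = space M" using N by (simp add: subalgebra_def)
  have "sets ?N \<subseteq> sets N"
    using sets_vimage_algebra2[of t "space M" N] measurable_sets[OF tN] measurable_space[OF tN] sp by auto
  then have NN': "subalgebra N ?N" by (simp add: subalgebra_def sp)
  have *: "?p (\<lambda>x. a x \<inter> c x) = (\<lambda>x. ?p a x \<inter> ?p c x)"
    by (auto simp: atom_pullback_def)
  have **: "cond_ent M K (\<lambda>x. ?p a x \<inter> space M \<inter> ?p c x) = cond_ent M K (?p (\<lambda>x. a x \<inter> c x))"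
    "cond_ent M K (\<lambda>x. space M \<inter> ?p c x) = cond_ent M K (?p c)" for K
    by (intro cond_ent_cong; auto simp: atom_pullback_def)+
  from cond_ent_submodular[OF N NN' atom_map_pullback[OF a tM] atom_map_space atom_map_pullback[OF c tM]]
  have "cond_ent M N (?p (\<lambda>x. a x \<inter> c x)) + cond_ent M ?N (?p c) \<le> cond_ent M N (?p c) + cond_ent M ?N (?p (\<lambda>x. a x \<inter> c x))"
    unfolding ** *[symmetric] .
  then show ?thesis
    using cond_ent_pullback[OF t N tN] a c atom_map_Int[OF a c] by simp
qed

lemma cond_ent_pullback_le:
  assumes "measure_preserving_map M t" "subalgebra M N" "t \<in> measurable N N" "atom_map M a"
  shows "cond_ent M N (atom_pullback M t a) \<le> cond_ent M N a"
proof -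
  have "cond_ent M N (atom_pullback M t (\<lambda>x. space M)) = cond_ent M N (\<lambda>x. space M)"
    using assms(1) by (intro cond_ent_cong) (auto simp: atom_pullback_def measure_preserving_map_def dest: measurable_space)
  moreover have "cond_ent M N (\<lambda>x. a x \<inter> space M) = cond_ent M N a"
    by (intro cond_ent_cong; use atom_mapD(2)[OF assms(4)] sets.sets_into_space in blast)
  moreover have "cond_ent M N (atom_pullback M t (\<lambda>x. a x \<inter> space M)) = cond_ent M N (atom_pullback M t a)"
    using assms(1) by (intro cond_ent_cong) (auto simp: atom_pullback_def measure_preserving_map_def dest: measurable_space)
  ultimately show ?thesis
    using cond_ent_pullback_submodular[OF assms atom_map_space] by (simp add: cond_ent_space assms(2))
qed

end

section \<open>Passing from partitions to atom maps\<close>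

text \<open>The members of \<open>P\<close> that no point meets are invisible to \<open>a\<close>. Partitions with the same atom map have the
  same entropies, and this identifies joins that are built in different ways.\<close>

definition describes :: "'a measure \<Rightarrow> 'a set set \<Rightarrow> ('a \<Rightarrow> 'a set) \<Rightarrow> bool" where
  "describes M P a \<longleftrightarrow> (\<forall>x\<in>space M. a x \<in> P \<and> x \<in> a x \<and> (\<forall>A\<in>P. x \<in> A \<longrightarrow> A = a x))"

lemma describesD:
  assumes "describes M P a" "x \<in> space M"
  shows "a x \<in> P" "x \<in> a x" "A \<in> P \<Longrightarrow> x \<in> A \<Longrightarrow> A = a x"
  using assms unfolding describes_def by blast+

lemma atom_of_eq:
  assumes "describes M P a" "x \<in> space M"
  shows "atom_of P x = a x"
  unfolding atom_of_def using describesD[OF assms] by (intro the_equality) blast+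

lemma describes_partition:
  assumes "meas_partition M \<alpha>"
  shows "describes M \<alpha> (atom_of \<alpha>)"
  unfolding describes_def
proof
  fix x assume "x \<in> space M"
  then obtain A where A: "A \<in> \<alpha>" "x \<in> A" using assms by (auto simp: meas_partition_def)
  have uniq: "B = A" if "B \<in> \<alpha>" "x \<in> B" for B
    using assms A that by (auto simp: meas_partition_def disjoint_def)
  have "atom_of \<alpha> x = A"
    unfolding atom_of_def using A uniq by (intro the_equality) blast+
  then show "atom_of \<alpha> x \<in> \<alpha> \<and> x \<in> atom_of \<alpha> x \<and> (\<forall>B\<in>\<alpha>. x \<in> B \<longrightarrow> B = atom_of \<alpha> x)"
    using A uniq by blast
qed

lemma atom_map_partition:
  assumes "meas_partition M \<alpha>"
  shows "atom_map M (atom_of \<alpha>)"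
  unfolding atom_map_def
proof (intro conjI ballI)
  note d = describesD[OF describes_partition[OF assms]]
  have "atom_of \<alpha> ` space M \<subseteq> \<alpha>" using d(1) by blast
  then show "countable (atom_of \<alpha> ` space M)"
    by (rule countable_subset) (use assms in \<open>simp add: meas_partition_def\<close>)
  fix x assume x: "x \<in> space M"
  show "x \<in> atom_of \<alpha> x" by (rule d(2)[OF x])
  show sets: "atom_of \<alpha> x \<in> sets M" using d(1)[OF x] assms by (auto simp: meas_partition_def)
  fix y assume y: "y \<in> atom_of \<alpha> x"
  then have "y \<in> space M" using sets sets.sets_into_space by blast
  then show "atom_of \<alpha> y = atom_of \<alpha> x" using d(3)[OF _ d(1)[OF x] y] by simp
qed

lemma describes_join:
  assumes P: "describes M P a" and Q: "describes M Q b"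
  shows "describes M (join P Q) (\<lambda>x. a x \<inter> b x)"
  unfolding describes_def
proof (intro ballI conjI impI)
  fix x assume x: "x \<in> space M"
  show "a x \<inter> b x \<in> join P Q" "x \<in> a x \<inter> b x"
    using describesD(1,2)[OF P x] describesD(1,2)[OF Q x] by (auto simp: join_def)
  fix E assume "E \<in> join P Q" "x \<in> E"
  then obtain A B where "A \<in> P" "B \<in> Q" "x \<in> A" "x \<in> B" "E = A \<inter> B" by (auto simp: join_def)
  then show "E = a x \<inter> b x"
    using describesD(3)[OF P x] describesD(3)[OF Q x] by simp
qed

lemma describes_pullback:
  assumes P: "describes M P a" and t: "\<And>x. x \<in> space M \<Longrightarrow> t x \<in> space M"
  shows "describes M (pullback M t P) (atom_pullback M t a)"
  unfolding describes_def
proof (intro ballI conjI impI)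
  fix x assume x: "x \<in> space M"
  show "atom_pullback M t a x \<in> pullback M t P" "x \<in> atom_pullback M t a x"
    using describesD(1,2)[OF P t[OF x]] x by (auto simp: pullback_def atom_pullback_def)
  fix E assume "E \<in> pullback M t P" "x \<in> E"
  then obtain A where "A \<in> P" "t x \<in> A" "E = t -` A \<inter> space M" by (auto simp: pullback_def)
  then show "E = atom_pullback M t a x"
    using describesD(3)[OF P t[OF x]] by (simp add: atom_pullback_def)
qed

lemma describes_Join:
  assumes P: "\<And>i. i \<in> I \<Longrightarrow> describes M (P i) (a i)"
  shows "describes M (Join M I P) (\<lambda>x. space M \<inter> (\<Inter>i\<in>I. a i x))"
  unfolding describes_def
proof (intro ballI conjI impI)
  fix x assume x: "x \<in> space M"
  have "\<forall>i\<in>I. a i x \<in> P i" using describesD(1)[OF P x] by blast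
  then show "space M \<inter> (\<Inter>i\<in>I. a i x) \<in> Join M I P"
    unfolding Join_def by (intro CollectI exI[of _ "\<lambda>i. a i x"]) simp
  show "x \<in> space M \<inter> (\<Inter>i\<in>I. a i x)" using describesD(2)[OF P x] x by blast
  fix E assume "E \<in> Join M I P" "x \<in> E"
  then obtain A where A: "\<forall>i\<in>I. A i \<in> P i" "\<forall>i\<in>I. x \<in> A i" "E = space M \<inter> (\<Inter>i\<in>I. A i)"
    by (auto simp: Join_def)
  then have "A i = a i x" if "i \<in> I" for i
    using describesD(3)[OF P x] that by blast
  then show "E = space M \<inter> (\<Inter>i\<in>I. a i x)" unfolding A(3) by simp
qed

lemma describes_cong:
  assumes "describes M P a" "\<And>x. x \<in> space M \<Longrightarrow> a x = b x"
  shows "describes M P b"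
  using assms unfolding describes_def by auto

lemma (in prob_space) cond_entropy_H_eq_cond_ent:
  assumes P: "describes M P a" and a: "atom_map M a" and N: "subalgebra M (sigma (space M) \<F>)"
  shows "cond_entropy_H M P \<F> = cond_ent M (sigma (space M) \<F>) a"
proof -
  let ?N = "sigma (space M) \<F>"
  have "AE x in M. real_cond_exp M ?N (indicator (a x)) x = cond_prob M ?N (a x) x"
    by (rule AE_atom_map[OF a, of "\<lambda>A x. real_cond_exp M ?N (indicator A) x = cond_prob M ?N A x"])
      (rule cond_prob_AE(1)[OF N atom_map_range[OF a]])
  with AE_space show ?thesis
    unfolding cond_entropy_H_def cond_ent_def
    by (intro nn_integral_cong_AE; eventually_elim; simp add: atom_of_eq[OF P])
qed

text \<open>This transfers finiteness from \<open>entropy_H\<close>, a sum over the whole partition, to the integral over the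
  range of its atom map, from which empty members are absent.\<close>

lemma nn_integral_count_space_le_infsum:
  fixes f :: "'b \<Rightarrow> ennreal"
  assumes B: "countable B" and BA: "B \<subseteq> A"
  shows "(\<integral>\<^sup>+x. f x \<partial>count_space B) \<le> infsum f A"
proof -
  \<comment> \<open>exhausting \<open>B\<close> by finite sets along an enumeration\<close>
  define C where "C n = {x \<in> B. to_nat_on B x \<le> n}" for n
  have "finite (C n)" for n
  proof (rule finite_imageD)
    show "finite (to_nat_on B ` C n)" by (rule finite_subset[of _ "{..n}"]) (auto simp: C_def)
    show "inj_on (to_nat_on B) (C n)"
      using inj_on_to_nat_on[OF B] by (rule inj_on_subset) (auto simp: C_def)
  qed
  have lim: "(\<lambda>n. \<integral>\<^sup>+x. f x * indicator (C n) x \<partial>count_space B) \<longlonglongrightarrow> (\<integral>\<^sup>+x. f x * indicator B x \<partial>count_space B)"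
  proof (rule nn_integral_LIMSEQ)
    show "incseq (\<lambda>n x. f x * indicator (C n) x)"
      by (auto simp: incseq_def le_fun_def C_def split: split_indicator)
    fix x
    have "eventually (\<lambda>n. f x * indicator (C n) x = f x * indicator B x) sequentially"
      using eventually_ge_at_top[of "to_nat_on B x"]
      by eventually_elim (auto simp: C_def split: split_indicator)
    then show "(\<lambda>n. f x * indicator (C n) x) \<longlonglongrightarrow> f x * indicator B x"
      by (rule tendsto_eventually)
  qed simp
  have "(\<integral>\<^sup>+x. f x * indicator (C n) x \<partial>count_space B) \<le> infsum f A" for n
  proof -
    have "(\<integral>\<^sup>+x. f x * indicator (C n) x \<partial>count_space B) = (\<Sum>x\<in>C n. f x * indicator (C n) x)"
      using \<open>finite (C n)\<close> by (intro nn_integral_count_space') (auto simp: C_def)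
    also have "\<dots> = sum f (C n)" by (intro sum.cong) auto
    also have "\<dots> \<le> infsum f A"
      unfolding nonneg_infsum_complete[of A f, simplified]
      using \<open>finite (C n)\<close> BA by (intro SUP_upper) (auto simp: C_def)
    finally show ?thesis .
  qed
  then have "(\<integral>\<^sup>+x. f x * indicator B x \<partial>count_space B) \<le> infsum f A"
    by (intro LIMSEQ_le_const2[OF lim]) auto
  moreover have "(\<integral>\<^sup>+x. f x * indicator B x \<partial>count_space B) = (\<integral>\<^sup>+x. f x \<partial>count_space B)"
    by (intro nn_integral_cong) simp
  ultimately show ?thesis by simp
qed

lemma (in prob_space) cond_ent_partition_finite:
  assumes \<alpha>: "meas_partition M \<alpha>" and fin: "entropy_H M \<alpha> < \<infinity>" and N: "subalgebra M N"
  shows "cond_ent M N (atom_of \<alpha>) < \<infinity>"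
proof -
  note a = atom_map_partition[OF \<alpha>]
  let ?e = "\<lambda>A. ennreal (- (measure M A * ln (measure M A)))"
  have "subalgebra N (sigma (space M) {})"
    using N sets.top[of N] by (auto simp: subalgebra_def sigma_sets_empty_eq)
  then have "cond_ent M N (atom_of \<alpha>) \<le> cond_ent M (sigma (space M) {}) (atom_of \<alpha>)"
    by (rule cond_ent_le_subalgebra[OF N _ a])
  also have "\<dots> = (\<integral>\<^sup>+A. ?e A \<partial>count_space (atom_of \<alpha> ` space M))"
    by (rule cond_ent_trivial[OF a])
  also have "\<dots> \<le> entropy_H M \<alpha>"
    unfolding entropy_H_def
    by (rule nn_integral_count_space_le_infsum[OF atom_map_countable[OF a]])
      (use describesD(1)[OF describes_partition[OF \<alpha>]] in blast)
  finally show ?thesis using fin by (rule le_less_trans)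
qed

section \<open>Translation-subinvariant submodular functions on a monoid\<close>

text \<open>The function \<open>h\<close> stands for the entropy of the joins over finite subsets of a monoid. The index set
  \<open>I\<close> of the generators plays the role of \<open>{1..r}\<close>, so that \<open>card I\<close> is the rank.\<close>

locale shift_entropy = monoid G for G (structure) +
  fixes I :: "'i set" and s :: "'i \<Rightarrow> 'a" and h :: "'a set \<Rightarrow> real"
  assumes finite_I [simp]: "finite I"
    and s_closed: "i \<in> I \<Longrightarrow> s i \<in> carrier G"
    and h_empty: "h {} = 0"
    and h_mono: "L \<in> Fpow (carrier G) \<Longrightarrow> K \<subseteq> L \<Longrightarrow> h K \<le> h L"
    and h_submodular: "K \<in> Fpow (carrier G) \<Longrightarrow> L \<in> Fpow (carrier G) \<Longrightarrow> P \<in> Fpow (carrier G) \<Longrightarrow>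
      h (K \<union> L \<union> P) + h P \<le> h (K \<union> P) + h (L \<union> P)"
    and h_shift: "i \<in> I \<Longrightarrow> K \<in> Fpow (carrier G) \<Longrightarrow> L \<in> Fpow (carrier G) \<Longrightarrow>
      h ((\<lambda>g. g \<otimes> s i) ` (K \<union> L)) - h ((\<lambda>g. g \<otimes> s i) ` L) \<le> h (K \<union> L) - h L"
begin

abbreviation finsets :: "'a set set" where "finsets \<equiv> Fpow (carrier G)"

definition rtrans :: "'a set \<Rightarrow> 'a \<Rightarrow> 'a set" where
  "rtrans K g = (\<lambda>k. k \<otimes> g) ` K"

text \<open>Conditional entropy of the join over \<open>K\<close> given the join over \<open>L\<close>.\<close>

definition h_given :: "'a set \<Rightarrow> 'a set \<Rightarrow> real" where
  "h_given K L = h (K \<union> L) - h L"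

definition F :: "'a set \<Rightarrow> real" where
  "F K = (1 - 2 * real (card I)) * h K + (\<Sum>i\<in>I. h (K \<union> rtrans K (s i)))"

definition chain :: "'i \<Rightarrow> 'a set \<Rightarrow> nat \<Rightarrow> 'a set" where
  "chain i K n = (\<Union>j\<le>n. rtrans K (s i [^] j))"

definition rate :: "'i \<Rightarrow> 'a set \<Rightarrow> real" where
  "rate i K = lim (\<lambda>n. h (chain i K n) / real (n + 1))"

definition Fstar :: "'a set \<Rightarrow> real" where
  "Fstar K = (1 - real (card I)) * h K + (\<Sum>i\<in>I. rate i K)"

lemma finsets_Un [simp]: "K \<in> finsets \<Longrightarrow> L \<in> finsets \<Longrightarrow> K \<union> L \<in> finsets"
  by (auto simp: Fpow_def)

lemma finsets_rtrans [simp]: "K \<in> finsets \<Longrightarrow> g \<in> carrier G \<Longrightarrow> rtrans K g \<in> finsets"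
  by (auto simp: Fpow_def rtrans_def)

lemma finsets_empty [simp]: "{} \<in> finsets"
  by (auto simp: Fpow_def)

lemma rtrans_Un: "rtrans (K \<union> L) g = rtrans K g \<union> rtrans L g"
  by (auto simp: rtrans_def)

lemma rtrans_one: "K \<in> finsets \<Longrightarrow> rtrans K \<one> = K"
  by (force simp: rtrans_def Fpow_def image_iff)

lemma rtrans_rtrans:
  assumes "K \<in> finsets" "g \<in> carrier G" "k \<in> carrier G"
  shows "rtrans (rtrans K g) k = rtrans K (g \<otimes> k)"
  using assms by (force simp: rtrans_def Fpow_def image_iff m_assoc)

lemma card_I_pred: "i \<in> I \<Longrightarrow> real (card I - Suc 0) = real (card I) - 1"
  using card_gt_0_iff[of I] by (auto simp: of_nat_diff)

lemma h_nonneg: "K \<in> finsets \<Longrightarrow> 0 \<le> h K"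
  using h_mono[of K "{}"] h_empty by simp

lemma h_given_chain: "h_given (K \<union> L) P = h_given K P + h_given L (K \<union> P)"
  unfolding h_given_def by (simp add: Un_ac)

text \<open>This is the form in which submodularity is used throughout.\<close>

lemma h_given_antimono:
  assumes "K \<in> finsets" "L \<in> finsets" "P \<subseteq> L"
  shows "h_given K L \<le> h_given K P"
proof -
  have P: "P \<in> finsets" using assms by (auto simp: Fpow_def intro: finite_subset)
  have "L \<union> P = L" using assms by auto
  then show ?thesis
    unfolding h_given_def using h_submodular[OF assms(1,2) P] by (simp add: Un_assoc)
qed

lemma h_given_le_h: "K \<in> finsets \<Longrightarrow> L \<in> finsets \<Longrightarrow> h_given K L \<le> h K"
  using h_given_antimono[of K L "{}"] by (simp add: h_given_def h_empty)

lemma h_given_shift: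
  assumes "i \<in> I" "K \<in> finsets" "L \<in> finsets"
  shows "h_given (rtrans K (s i)) (rtrans L (s i)) \<le> h_given K L"
  using h_shift[OF assms] unfolding h_given_def rtrans_def by (simp add: image_Un)

lemma h_given_pow_shift:
  assumes i: "i \<in> I" and K: "K \<in> finsets" and L: "L \<in> finsets"
  shows "h_given (rtrans K (s i [^] (n::nat))) (rtrans L (s i [^] n)) \<le> h_given K L"
proof (induction n)
  case 0
  then show ?case by (simp add: rtrans_one K L)
next
  case (Suc n)
  have "h_given (rtrans K (s i [^] Suc n)) (rtrans L (s i [^] Suc n)) =
      h_given (rtrans (rtrans K (s i [^] n)) (s i)) (rtrans (rtrans L (s i [^] n)) (s i))"
    using s_closed[OF i] by (simp add: rtrans_rtrans K L)
  also have "\<dots> \<le> h_given (rtrans K (s i [^] n)) (rtrans L (s i [^] n))"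
    using s_closed[OF i] by (intro h_given_shift i) (simp_all add: K L)
  finally show ?case using Suc by linarith
qed

lemma chain_0: "K \<in> finsets \<Longrightarrow> chain i K 0 = K"
  by (simp add: chain_def rtrans_one)

lemma chain_Suc: "chain i K (Suc n) = chain i K n \<union> rtrans K (s i [^] Suc n)"
  by (auto simp: chain_def atMost_Suc)

lemma finsets_chain [simp]: "i \<in> I \<Longrightarrow> K \<in> finsets \<Longrightarrow> chain i K n \<in> finsets"
  using s_closed by (induction n) (simp_all add: chain_0 chain_Suc)

lemma subset_chain: "K \<in> finsets \<Longrightarrow> K \<subseteq> chain i K n"
  by (induction n) (auto simp: chain_0 chain_Suc)

text \<open>A chain can also be grown at its beginning. This displays the translate of the shorter chain
  inside the longer one, as the monotonicity of the increments requires.\<close>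

lemma chain_Suc_left:
  assumes i: "i \<in> I" and K: "K \<in> finsets"
  shows "chain i K (Suc n) = K \<union> rtrans (chain i K n) (s i)"
proof (induction n)
  case 0
  show ?case using s_closed[OF i] by (simp add: chain_Suc chain_0 K)
next
  case (Suc n)
  have "chain i K (Suc (Suc n)) = K \<union> rtrans (chain i K n) (s i) \<union> rtrans K (s i [^] Suc (Suc n))"
    using Suc by (simp add: chain_Suc)
  also have "rtrans K (s i [^] Suc (Suc n)) = rtrans (rtrans K (s i [^] Suc n)) (s i)"
    using s_closed[OF i] by (simp add: rtrans_rtrans K)
  finally show ?case by (simp add: chain_Suc rtrans_Un Un_assoc)
qed

definition incr :: "'i \<Rightarrow> 'a set \<Rightarrow> nat \<Rightarrow> real" where
  "incr i K n = h_given (rtrans K (s i [^] Suc n)) (chain i K n)"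

lemma h_chain_Suc: "h (chain i K (Suc n)) = h (chain i K n) + incr i K n"
  by (simp add: incr_def h_given_def chain_Suc Un_commute)

lemma incr_alt:
  assumes i: "i \<in> I" and K: "K \<in> finsets"
  shows "incr i K n = h_given (rtrans (chain i K n) (s i)) (chain i K n)"
proof -
  have "rtrans (chain i K n) (s i) \<union> chain i K n = chain i K (Suc n)"
    using subset_chain[OF K, of i n] chain_Suc_left[OF i K, of n] chain_Suc[of i K n] by blast
  then show ?thesis
    by (simp add: incr_def h_given_def chain_Suc Un_commute)
qed

text \<open>The new increment is the old one shifted by the generator and conditioned on more.\<close>

lemma incr_decreasing:
  assumes i: "i \<in> I" and K: "K \<in> finsets"
  shows "incr i K (Suc n) \<le> incr i K n"
proof -
  have si: "s i \<in> carrier G" by (rule s_closed[OF i])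
  have "incr i K (Suc n) = h_given (rtrans K (s i [^] Suc (Suc n))) (chain i K (Suc n))"
    by (simp add: incr_def)
  also have "\<dots> \<le> h_given (rtrans K (s i [^] Suc (Suc n))) (rtrans (chain i K n) (s i))"
    using chain_Suc_left[OF i K, of n] si by (intro h_given_antimono) (simp_all add: i K)
  also have "rtrans K (s i [^] Suc (Suc n)) = rtrans (rtrans K (s i [^] Suc n)) (s i)"
    using si by (simp add: rtrans_rtrans K)
  also have "h_given \<dots> (rtrans (chain i K n) (s i)) \<le> incr i K n"
    unfolding incr_def using si by (intro h_given_shift i) (simp_all add: i K)
  finally show ?thesis .
qed

lemma incr_antimono: "i \<in> I \<Longrightarrow> K \<in> finsets \<Longrightarrow> m \<le> n \<Longrightarrow> incr i K n \<le> incr i K m"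
  by (rule lift_Suc_antimono_le[of "incr i K"]) (auto intro: incr_decreasing)

text \<open>The increments decrease and the first is at most \<open>h K\<close>, so \<open>h\<close> of a chain dominates the next
  increment times the number of links. This makes the averages that define the rate decrease.\<close>

lemma h_chain_ge:
  assumes i: "i \<in> I" and K: "K \<in> finsets"
  shows "real (n + 1) * incr i K n \<le> h (chain i K n)"
proof (induction n)
  case 0
  have "incr i K 0 \<le> h (rtrans K (s i))"
    unfolding incr_def using s_closed[OF i] by (auto intro!: h_given_le_h simp: K i)
  also have "\<dots> \<le> h K"
    using h_given_shift[OF i K, of "{}"] by (simp add: h_given_def rtrans_def)
  finally show ?case by (simp add: chain_0 K)
next
  case (Suc n)
  have "real (Suc n + 1) * incr i K (Suc n) \<le> real (Suc n + 1) * incr i K n"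
    by (intro mult_left_mono incr_decreasing i K) simp
  also have "\<dots> = real (n + 1) * incr i K n + incr i K n"
    by (simp add: algebra_simps)
  finally show ?case using Suc by (simp add: h_chain_Suc)
qed

lemma rate_LIMSEQ:
  assumes i: "i \<in> I" and K: "K \<in> finsets"
  shows "(\<lambda>n. h (chain i K n) / real (n + 1)) \<longlonglongrightarrow> rate i K"
proof -
  let ?a = "\<lambda>n. h (chain i K n) / real (n + 1)"
  have "decseq ?a"
  proof (rule decseq_SucI)
    fix n
    have "real (n + 1) * h (chain i K (Suc n)) \<le> real (n + 2) * h (chain i K n)"
      using h_chain_ge[OF i K, of n] by (simp add: h_chain_Suc algebra_simps)
    then show "?a (Suc n) \<le> ?a n"
      by (simp add: field_simps)
  qed
  moreover have "\<bar>?a n\<bar> \<le> h K" for n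
  proof -
    have "h (chain i K n) / real (n + 1) \<le> h (chain i K 0) / real (0 + 1)"
      using \<open>decseq ?a\<close> unfolding decseq_def by blast
    moreover have "0 \<le> h (chain i K n)" by (rule h_nonneg) (simp add: i K)
    ultimately show ?thesis by (simp add: chain_0 K)
  qed
  ultimately have "convergent ?a"
    by (intro Bseq_monoseq_convergent BseqI'[of _ "h K"]) (auto simp: monoseq_iff)
  then show ?thesis
    unfolding rate_def by (simp add: convergent_LIMSEQ_iff)
qed

lemma averages_LIMSEQ: "(\<lambda>n. (c + real n * x) / real (n + 1)) \<longlonglongrightarrow> x"
proof -
  have "(\<lambda>n. x + (c - x) * (1 / real (n + 1))) \<longlonglongrightarrow> x + (c - x) * 0"
    by (intro tendsto_intros) (use LIMSEQ_inverse_real_of_nat in \<open>simp add: inverse_eq_divide\<close>)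
  moreover have "x + (c - x) * (1 / real (n + 1)) = (c + real n * x) / real (n + 1)" for n
    by (simp add: field_simps)
  ultimately show ?thesis by simp
qed

lemma rate_le_h_given:
  assumes i: "i \<in> I" and K: "K \<in> finsets"
  shows "rate i K \<le> h_given (rtrans K (s i)) K"
proof -
  have inc: "incr i K n \<le> h_given (rtrans K (s i)) K" for n
    using incr_antimono[OF i K, of 0 n] incr_alt[OF i K, of 0] by (simp add: chain_0 K)
  have "h (chain i K n) \<le> h K + real n * h_given (rtrans K (s i)) K" for n
  proof (induction n)
    case (Suc n)
    then show ?case using inc[of n] by (simp add: h_chain_Suc algebra_simps)
  qed (simp add: chain_0 K)
  then show ?thesis
    by (intro LIMSEQ_le[OF rate_LIMSEQ[OF i K] averages_LIMSEQ[of "h K"]])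
      (auto intro!: divide_right_mono)
qed

lemma Fstar_le_F: "K \<in> finsets \<Longrightarrow> Fstar K \<le> F K"
proof -
  assume K: "K \<in> finsets"
  have "(\<Sum>i\<in>I. rate i K) \<le> (\<Sum>i\<in>I. h (K \<union> rtrans K (s i)) - h K)"
    using rate_le_h_given[OF _ K] by (intro sum_mono) (simp add: h_given_def Un_commute)
  then show ?thesis
    unfolding Fstar_def F_def by (simp add: sum_subtractf algebra_simps)
qed

lemma exists_incr_near_rate:
  assumes i: "i \<in> I" and K: "K \<in> finsets" and e: "0 < e"
  obtains n where "incr i K n \<le> rate i K + e"
proof -
  have "\<exists>n. incr i K n \<le> rate i K + e"
  proof (rule ccontr)
    \<comment> \<open>otherwise the averages of the increments would stay above the rate\<close>
    assume "\<not> ?thesis"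
    then have inc: "rate i K + e < incr i K n" for n by (meson not_le)
    have "h K + real n * (rate i K + e) \<le> h (chain i K n)" for n
    proof (induction n)
      case (Suc n)
      then show ?case using inc[of n] by (simp add: h_chain_Suc algebra_simps)
    qed (simp add: chain_0 K)
    then have "rate i K + e \<le> rate i K"
      by (intro LIMSEQ_le[OF averages_LIMSEQ[of "h K"] rate_LIMSEQ[OF i K]])
        (auto intro!: divide_right_mono)
    then show False using e by simp
  qed
  then show thesis using that by blast
qed

text \<open>Enlarging \<open>K\<close> to \<open>L\<close> raises each increment, and therefore the rate, by at most \<open>h(L | K)\<close>: given the
  link \<open>K s\<^sup>n\<close>, the link \<open>L s\<^sup>n\<close> costs no more than \<open>L\<close> given \<open>K\<close>.\<close>

lemma rate_superset_le:
  assumes i: "i \<in> I" and L: "L \<in> finsets" and KL: "K \<subseteq> L"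
  shows "rate i L \<le> rate i K + h_given L K"
proof -
  have K: "K \<in> finsets" using L KL by (auto simp: Fpow_def intro: finite_subset)
  have si: "s i \<in> carrier G" by (rule s_closed[OF i])
  have sub: "chain i K n \<subseteq> chain i L n" for n
    using KL by (auto simp: chain_def rtrans_def)
  have inc: "incr i L n \<le> incr i K n + h_given L K" for n
  proof -
    let ?L = "rtrans L (s i [^] Suc n)" and ?K = "rtrans K (s i [^] Suc n)"
    have "?L = ?K \<union> ?L" using KL by (auto simp: rtrans_def)
    then have "incr i L n = h_given ?K (chain i L n) + h_given ?L (?K \<union> chain i L n)"
      unfolding incr_def by (metis h_given_chain)
    also have "h_given ?K (chain i L n) \<le> incr i K n"
      unfolding incr_def using sub si by (intro h_given_antimono) (simp_all add: K L i)
    also have "h_given ?L (?K \<union> chain i L n) \<le> h_given ?L ?K"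
      using si by (intro h_given_antimono) (simp_all add: K L i)
    also have "\<dots> \<le> h_given L K" by (rule h_given_pow_shift[OF i L K])
    finally show ?thesis by simp
  qed
  have "h (chain i L n) \<le> h (chain i K n) + real (n + 1) * h_given L K" for n
  proof (induction n)
    case 0
    have "L \<union> K = L" using KL by auto
    then show ?case by (simp add: chain_0 K L h_given_def)
  next
    case (Suc n)
    then show ?case using inc[of n] by (simp add: h_chain_Suc algebra_simps)
  qed
  then have "h (chain i L n) / real (n + 1) \<le> (h (chain i K n) + real (n + 1) * h_given L K) / real (n + 1)" for n
    by (intro divide_right_mono) simp_all
  then have "h (chain i L n) / real (n + 1) \<le> h (chain i K n) / real (n + 1) + h_given L K" for n
    by (simp add: add_divide_distrib)
  then show ?thesis
    by (intro LIMSEQ_le[OF rate_LIMSEQ[OF i L] tendsto_add[OF rate_LIMSEQ[OF i K] tendsto_const]]) auto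
qed

text \<open>The same bound as for the rate, by the same splitting of \<open>L s\<close> into \<open>K s\<close> and the rest.\<close>

lemma h_given_rtrans_superset_le:
  assumes i: "i \<in> I" and L: "L \<in> finsets" and KL: "K \<subseteq> L"
  shows "h_given (rtrans L (s i)) L \<le> h_given (rtrans K (s i)) K + h_given L K"
proof -
  have K: "K \<in> finsets" using L KL by (auto simp: Fpow_def intro: finite_subset)
  have si: "s i \<in> carrier G" by (rule s_closed[OF i])
  let ?L = "rtrans L (s i)" and ?K = "rtrans K (s i)"
  have "?L = ?K \<union> ?L" using KL by (auto simp: rtrans_def)
  then have "h_given ?L L = h_given ?K L + h_given ?L (?K \<union> L)"
    by (metis h_given_chain)
  also have "h_given ?K L \<le> h_given ?K K"
    using KL si by (intro h_given_antimono) (simp_all add: K L)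
  also have "h_given ?L (?K \<union> L) \<le> h_given ?L ?K"
    using si by (intro h_given_antimono) (simp_all add: K L)
  also have "\<dots> \<le> h_given L K" by (rule h_given_shift[OF i L K])
  finally show ?thesis by simp
qed

text \<open>This interpolates between \<open>F\<close> (for \<open>J = {}\<close>) and \<open>Fstar\<close> (for \<open>J = I\<close>): the generators in \<open>J\<close> contribute
  their rates, the others their one-step conditional entropies.\<close>

definition mixed :: "'i set \<Rightarrow> 'a set \<Rightarrow> real" where
  "mixed J K = (1 - real (card I)) * h K +
     (\<Sum>i\<in>I. if i \<in> J then rate i K else h_given (rtrans K (s i)) K)"

lemma mixed_empty: "mixed {} K = F K"
  unfolding mixed_def F_def h_given_def by (simp add: sum_subtractf algebra_simps Un_commute)

lemma mixed_all: "mixed I K = Fstar K"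
  unfolding mixed_def Fstar_def by simp

text \<open>Passing to a long chain in the direction \<open>s i\<close> trades the one-step entropy of \<open>s i\<close> for its rate. The
  loss \<open>h(L | K)\<close> in each of the other \<open>card I - 1\<close> directions is compensated exactly by the coefficient
  \<open>1 - card I\<close> of \<open>h\<close>.\<close>

lemma mixed_step:
  assumes i: "i \<in> I" "i \<notin> J" and K: "K \<in> finsets" and e: "0 < e"
  obtains L where "L \<in> finsets" "K \<subseteq> L" "mixed J L \<le> mixed (insert i J) K + e"
proof -
  obtain n where n: "incr i K n \<le> rate i K + e"
    using exists_incr_near_rate[OF i(1) K e] .
  let ?L = "chain i K n"
  have L: "?L \<in> finsets" and KL: "K \<subseteq> ?L"
    using i K by (auto intro: subset_chain[THEN subsetD])
  have hL: "h_given ?L K = h ?L - h K"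
    using KL by (simp add: h_given_def Un_absorb2)
  let ?t = "\<lambda>J K j. if j \<in> J then rate j K else h_given (rtrans K (s j)) K"
  have "?t J ?L j \<le> ?t (insert i J) K j + h_given ?L K" if "j \<in> I - {i}" for j
    using that rate_superset_le[OF _ L KL, of j] h_given_rtrans_superset_le[OF _ L KL, of j] by auto
  then have "(\<Sum>j\<in>I - {i}. ?t J ?L j) \<le> (\<Sum>j\<in>I - {i}. ?t (insert i J) K j + h_given ?L K)"
    by (rule sum_mono)
  also have "\<dots> = (\<Sum>j\<in>I - {i}. ?t (insert i J) K j) + (real (card I) - 1) * h_given ?L K"
    using i by (simp add: sum.distrib card_Diff_singleton card_I_pred)
  finally have others: "(\<Sum>j\<in>I - {i}. ?t J ?L j) \<le>
    (\<Sum>j\<in>I - {i}. ?t (insert i J) K j) + (real (card I) - 1) * (h ?L - h K)"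
    by (simp add: hL)
  have "?t J ?L i \<le> ?t (insert i J) K i + e"
    using n i incr_alt[OF i(1) K, of n] by simp
  moreover have "(\<Sum>j\<in>I. ?t J ?L j) = ?t J ?L i + (\<Sum>j\<in>I - {i}. ?t J ?L j)"
    using i(1) by (intro sum.remove) simp_all
  moreover have "(\<Sum>j\<in>I. ?t (insert i J) K j) =
      ?t (insert i J) K i + (\<Sum>j\<in>I - {i}. ?t (insert i J) K j)"
    using i(1) by (intro sum.remove) simp_all
  ultimately have "mixed J ?L \<le> mixed (insert i J) K + e"
    using others unfolding mixed_def by (simp only: left_diff_distrib right_diff_distrib mult_1_left)
  then show thesis using that L KL by blast
qed

lemma exists_F_near_Fstar:
  assumes K: "K \<in> finsets" and e: "0 < e"
  obtains L where "L \<in> finsets" "K \<subseteq> L" "F L \<le> Fstar K + e"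
proof -
  have "\<exists>L\<in>finsets. K \<subseteq> L \<and> F L \<le> mixed J K + e"
    if "finite J" "J \<subseteq> I" "K \<in> finsets" "0 < e" for J K e
    using that
  proof (induction J arbitrary: K e rule: finite_induct)
    case empty
    then show ?case by (auto simp: mixed_empty)
  next
    case (insert i J)
    obtain L where L: "L \<in> finsets" "K \<subseteq> L" "mixed J L \<le> mixed (insert i J) K + e / 2"
      using mixed_step[of i J K "e / 2"] insert.prems insert.hyps by auto
    obtain L' where "L' \<in> finsets" "L \<subseteq> L'" "F L' \<le> mixed J L + e / 2"
      using insert.IH[of L "e / 2"] insert.prems L by auto
    with L show ?case by (intro bexI[of _ L']) auto
  qed
  from this[of "I" K e] show thesis
    using K e that by (auto simp: mixed_all)
qed

text \<open>Adding \<open>x\<close> to \<open>K\<close> adds \<open>x\<close> and \<open>x s j\<close> to \<open>K \<union> K s j\<close>, which raises \<open>h\<close> by at most \<open>2 h(x | K)\<close> for each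
  generator. In the direction \<open>s i\<close> one of the two points is already present, so the rise is at most
  \<open>h(x | K)\<close> there. In total this is \<open>(2 r - 1) h(x | K)\<close>, which the coefficient \<open>1 - 2 r\<close> of \<open>h\<close> cancels.\<close>

lemma F_insert_le:
  assumes K: "K \<in> finsets" and x: "x \<in> carrier G" and i: "i \<in> I"
    and adj: "x \<in> rtrans K (s i) \<or> x \<otimes> s i \<in> K"
  shows "F (insert x K) \<le> F K"
proof -
  have X: "{x} \<in> finsets" using x by (simp add: Fpow_def)
  let ?d = "h_given {x} K"
  let ?g = "\<lambda>j. h (insert x K \<union> rtrans (insert x K) (s j)) - h (K \<union> rtrans K (s j))"
  have split: "?g j = h_given {x} (K \<union> rtrans K (s j)) +
       h_given (rtrans {x} (s j)) ({x} \<union> (K \<union> rtrans K (s j)))" for j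
  proof -
    have "insert x K \<union> rtrans (insert x K) (s j) =
        ({x} \<union> rtrans {x} (s j)) \<union> (K \<union> rtrans K (s j))"
      by (auto simp: rtrans_def)
    then show ?thesis
      using h_given_chain[of "{x}" "rtrans {x} (s j)" "K \<union> rtrans K (s j)"] by (simp add: h_given_def)
  qed
  have first: "h_given {x} (K \<union> rtrans K (s j)) \<le> ?d" if "j \<in> I" for j
    using that s_closed by (intro h_given_antimono) (auto simp: K X)
  have second: "h_given (rtrans {x} (s j)) ({x} \<union> (K \<union> rtrans K (s j))) \<le> ?d" if j: "j \<in> I" for j
  proof -
    have "h_given (rtrans {x} (s j)) ({x} \<union> (K \<union> rtrans K (s j))) \<le> h_given (rtrans {x} (s j)) (rtrans K (s j))"
      using j s_closed by (intro h_given_antimono finsets_Un finsets_rtrans) (auto simp: K X)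
    also have "\<dots> \<le> ?d" by (rule h_given_shift[OF j X K])
    finally show ?thesis .
  qed
  have "?g i \<le> ?d"
  proof (cases "x \<in> rtrans K (s i)")
    case True
    then have "h_given {x} (K \<union> rtrans K (s i)) = 0" by (simp add: h_given_def insert_absorb)
    then show ?thesis using split[of i] second[OF i] by simp
  next
    case False
    then have "x \<otimes> s i \<in> K" using adj by simp
    then have "h_given (rtrans {x} (s i)) ({x} \<union> (K \<union> rtrans K (s i))) = 0"
      by (simp add: h_given_def rtrans_def insert_absorb)
    then show ?thesis using split[of i] first[OF i] by simp
  qed
  moreover have "(\<Sum>j\<in>I - {i}. ?g j) \<le> (\<Sum>j\<in>I - {i}. 2 * ?d)"
    using first second split by (intro sum_mono) (smt (verit) DiffD1)
  moreover have "(\<Sum>j\<in>I - {i}. 2 * ?d) = (real (card I) - 1) * (2 * ?d)"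
    using i by (simp add: card_I_pred)
  moreover have "(\<Sum>j\<in>I. ?g j) = ?g i + (\<Sum>j\<in>I - {i}. ?g j)"
    using i by (intro sum.remove) simp_all
  ultimately have "(\<Sum>j\<in>I. ?g j) \<le> (2 * real (card I) - 1) * ?d"
    by (simp add: algebra_simps)
  then show ?thesis
    unfolding F_def by (simp add: sum_subtractf h_given_def algebra_simps)
qed

lemma F_Un_le:
  assumes K: "K \<in> finsets" and X: "X \<in> finsets"
    and adj: "\<And>x. x \<in> X \<Longrightarrow> \<exists>i\<in>I. x \<in> rtrans K (s i) \<or> x \<otimes> s i \<in> K"
  shows "F (X \<union> K) \<le> F K"
proof -
  have "finite X" using X by (simp add: Fpow_def)
  then show ?thesis using X adj
  proof (induction X rule: finite_induct)
    case (insert x X)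
    have X': "X \<in> finsets" and x: "x \<in> carrier G"
      using insert.prems(1) by (auto simp: Fpow_def)
    obtain i where i: "i \<in> I" "x \<in> rtrans K (s i) \<or> x \<otimes> s i \<in> K"
      using insert.prems(2)[of x] by auto
    then have "F (insert x (X \<union> K)) \<le> F (X \<union> K)"
      by (intro F_insert_le[of _ _ i]) (auto simp: X' K x rtrans_Un)
    moreover have "F (X \<union> K) \<le> F K"
      using insert.IH[OF X'] insert.prems(2) by simp
    ultimately show ?case by simp
  qed simp
qed

end

section \<open>Word balls\<close>

lemma word_prod_append:
  assumes "monoid G" "set u \<subseteq> carrier G" "set v \<subseteq> carrier G"
  shows "word_prod G (u @ v) = word_prod G u \<otimes>\<^bsub>G\<^esub> word_prod G v \<and> word_prod G u \<in> carrier G"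
proof -
  interpret monoid G by fact
  have "word_prod G v \<in> carrier G" using assms(3) by (induction v) (auto simp: word_prod_def)
  then show ?thesis using assms(2) by (induction u) (auto simp: word_prod_def m_assoc)
qed

context shift_entropy
begin

lemma word_ball_finsets:
  assumes S: "finite S" "S \<subseteq> carrier G"
  shows "word_ball G S n \<in> finsets"
proof -
  have eq: "word_ball G S n = word_prod G ` {w. set w \<subseteq> S \<and> length w \<le> n}"
    by (auto simp: word_ball_def)
  have "word_prod G w \<in> carrier G" if "set w \<subseteq> S" for w
    using word_prod_append[OF monoid_axioms, of w "[]"] that S by auto
  then show ?thesis
    unfolding Fpow_def eq using finite_lists_length_le[OF S(1)] by auto
qed

lemma one_in_word_ball: "\<one> \<in> word_ball G S n"
  unfolding word_ball_def by (intro CollectI exI[of _ "[]"]) (simp add: word_prod_def)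

lemma word_ball_Suc:
  assumes S: "S \<subseteq> carrier G" and x: "x \<in> word_ball G S (Suc n)" "x \<notin> word_ball G S n"
  obtains y u where "y \<in> word_ball G S n" "u \<in> S" "x = y \<otimes> u"
proof -
  obtain w where w: "set w \<subseteq> S" "length w \<le> Suc n" "x = word_prod G w"
    using x(1) by (auto simp: word_ball_def)
  have "w \<noteq> []" using w x(2) one_in_word_ball[of S n] by (auto simp: word_prod_def)
  then obtain v u where vu: "w = v @ [u]" by (metis rev_exhaust)
  have "word_prod G v \<in> word_ball G S n" using w vu by (auto simp: word_ball_def)
  moreover have "word_prod G [u] = u" using w vu S by (auto simp: word_prod_def)
  then have "x = word_prod G v \<otimes> u"
    using word_prod_append[OF monoid_axioms, of v "[u]"] w vu S by auto
  ultimately show thesis using that w vu by auto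
qed

text \<open>Starting from \<open>K\<close>, the balls of radius \<open>0, 1, \<dots>, n\<close> are added one after the other. An element of length
  \<open>m + 1\<close> is \<open>y u\<close> with \<open>y\<close> of length at most \<open>m\<close> and a letter \<open>u\<close>. If \<open>u\<close> is a generator, \<open>y u\<close> lies in a
  translate of the current set; if \<open>u\<close> is the inverse of a generator, translation by that generator
  takes \<open>y u\<close> back to \<open>y\<close>.\<close>

lemma F_word_ball_le:
  assumes S: "finite S" "S \<subseteq> carrier G"
    and gen: "\<And>u. u \<in> S \<Longrightarrow> \<exists>i\<in>I. u = s i \<or> u \<otimes> s i = \<one>"
    and K: "K \<in> finsets" "\<one> \<in> K" "K \<subseteq> word_ball G S n"
  shows "F (word_ball G S n) \<le> F K"
proof -
  note B = word_ball_finsets[OF S]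
  have "F (word_ball G S m \<union> K) \<le> F K" for m
  proof (induction m)
    case 0
    have "word_ball G S 0 = {\<one>}" by (auto simp: word_ball_def word_prod_def)
    then show ?case using K(2) by (simp add: insert_absorb)
  next
    case (Suc m)
    let ?X = "word_ball G S (Suc m) - word_ball G S m" and ?K = "word_ball G S m \<union> K"
    have X: "?X \<in> finsets" using B[of "Suc m"] by (auto simp: Fpow_def)
    have "F (?X \<union> ?K) \<le> F ?K"
    proof (rule F_Un_le[OF _ X])
      show "?K \<in> finsets" using B K by simp
      fix x assume "x \<in> ?X"
      then obtain y u where y: "y \<in> word_ball G S m" "u \<in> S" "x = y \<otimes> u"
        using word_ball_Suc[OF S(2)] by blast
      then obtain i where i: "i \<in> I" "u = s i \<or> u \<otimes> s i = \<one>" using gen by blast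
      have "y \<in> carrier G" "u \<in> carrier G" "s i \<in> carrier G"
        using y B[of m] S s_closed[OF i(1)] by (auto simp: Fpow_def)
      then have "x \<otimes> s i = y" if "u \<otimes> s i = \<one>" using that y by (simp add: m_assoc)
      then show "\<exists>i\<in>I. x \<in> rtrans ?K (s i) \<or> x \<otimes> s i \<in> ?K"
        using i y by (intro bexI[of _ i]) (auto simp: rtrans_def)
    qed
    moreover have "word_ball G S m \<subseteq> word_ball G S (Suc m)"
      by (auto simp: word_ball_def intro: le_SucI)
    then have "?X \<union> ?K = word_ball G S (Suc m) \<union> K" by blast
    ultimately show ?case using Suc by simp
  qed
  from this[of n] show ?thesis using K(3) by (simp add: Un_absorb2)
qed

end

section \<open>The entropy function of a measure-preserving action\<close>

locale mp_monoid_action = prob_space M + G: monoid G for M :: "'a measure" and G :: "('g, 'b) monoid_scheme" +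
  fixes T :: "'g \<Rightarrow> 'a \<Rightarrow> 'a" and \<alpha> :: "'a set set" and \<F> :: "'a set set"
  assumes action: "mp_action G M T"
    and partition: "meas_partition M \<alpha>" and finite_entropy: "entropy_H M \<alpha> < \<infinity>"
    and subalgebra: "sigma_algebra (space M) \<F>" "\<F> \<subseteq> sets M"
    and invariant: "G_invariant G M T \<F>"
begin

abbreviation N :: "'a measure" where "N \<equiv> sigma (space M) \<F>"

lemma sets_N: "sets N = \<F>"
  using sigma_algebra.sets_measure_of_eq[OF subalgebra(1)] by simp

lemma space_N: "space N = space M"
  by (simp add: space_measure_of_conv)

lemma N_subalgebra: "Conditional_Expectation.subalgebra M N"
  unfolding subalgebra_def sets_N using subalgebra(2) by (simp add: space_N)

lemma T_mp: "g \<in> carrier G \<Longrightarrow> measure_preserving_map M (T g)"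
  using action by (simp add: mp_action_def)

lemma T_measurable: "g \<in> carrier G \<Longrightarrow> T g \<in> measurable M M"
  using T_mp by (simp add: measure_preserving_map_def)

lemma T_space: "g \<in> carrier G \<Longrightarrow> x \<in> space M \<Longrightarrow> T g x \<in> space M"
  using T_measurable by (rule measurable_space)

lemma T_one: "x \<in> space M \<Longrightarrow> T \<one>\<^bsub>G\<^esub> x = x"
  using action by (simp add: mp_action_def)

lemma T_mult: "g \<in> carrier G \<Longrightarrow> k \<in> carrier G \<Longrightarrow> x \<in> space M \<Longrightarrow> T (g \<otimes>\<^bsub>G\<^esub> k) x = T g (T k x)"
  using action by (simp add: mp_action_def)

lemma T_pow: "g \<in> carrier G \<Longrightarrow> x \<in> space M \<Longrightarrow> (T g ^^ n) x = T (g [^]\<^bsub>G\<^esub> n) x"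
proof (induction n arbitrary: x)
  case 0
  then show ?case by (simp add: T_one)
next
  case (Suc n)
  then show ?case by (simp add: T_mult T_space funpow_Suc_right del: funpow.simps)
qed

lemma T_measurable_N: "g \<in> carrier G \<Longrightarrow> T g \<in> measurable N N"
  using invariant T_space by (intro measurableI) (auto simp: sets_N space_N G_invariant_def)

text \<open>The atom map of the join of the partitions \<open>T\<^sub>g\<^sup>-\<^sup>1 \<alpha>\<close> with \<open>g \<in> K\<close>. Intersecting with the space gives the
  trivial partition for \<open>K = {}\<close>.\<close>

definition atoms :: "'g set \<Rightarrow> 'a \<Rightarrow> 'a set" where
  "atoms K x = space M \<inter> (\<Inter>g\<in>K. atom_pullback M (T g) (atom_of \<alpha>) x)"

lemma atoms_Un: "atoms (K \<union> L) = (\<lambda>x. atoms K x \<inter> atoms L x)"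
  by (rule ext) (auto simp: atoms_def)

lemma atoms_empty: "atoms {} = (\<lambda>x. space M)"
  by (simp add: atoms_def fun_eq_iff)

lemma atom_map_atoms:
  assumes "K \<in> Fpow (carrier G)"
  shows "atom_map M (atoms K)"
proof -
  have "finite K" "K \<subseteq> carrier G" using assms by (auto simp: Fpow_def)
  then show ?thesis
  proof (induction K rule: finite_induct)
    case empty
    then show ?case by (simp add: atoms_empty atom_map_space)
  next
    case (insert g K)
    have "atoms {g} = (\<lambda>x. space M \<inter> atom_pullback M (T g) (atom_of \<alpha>) x)"
      by (simp add: atoms_def fun_eq_iff)
    then have "atom_map M (atoms {g})"
      using insert.prems atom_map_Int[OF atom_map_space atom_map_pullback[OF atom_map_partition[OF partition] T_measurable]]
      by simp
    then show ?case
      using atom_map_Int[of M "atoms {g}" "atoms K"] insert by (simp add: atoms_Un[symmetric])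
  qed
qed

text \<open>Since \<open>T\<^sub>k\<^sub>g = T\<^sub>k T\<^sub>g\<close>, pulling back along \<open>T\<^sub>g\<close> translates \<open>K\<close> on the right.\<close>

lemma atoms_translate:
  assumes K: "K \<subseteq> carrier G" and g: "g \<in> carrier G" and x: "x \<in> space M"
  shows "atoms ((\<lambda>k. k \<otimes>\<^bsub>G\<^esub> g) ` K) x = atom_pullback M (T g) (atoms K) x"
proof -
  have "T (k \<otimes>\<^bsub>G\<^esub> g) y = T k (T g y)" if "k \<in> K" "y \<in> space M" for k y
    using that K g by (intro T_mult) auto
  then have "atom_pullback M (T (k \<otimes>\<^bsub>G\<^esub> g)) (atom_of \<alpha>) x =
      atom_pullback M (T g) (atom_pullback M (T k) (atom_of \<alpha>)) x" if "k \<in> K" for k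
    using that x T_space[OF g] by (auto simp: atom_pullback_def)
  then have "atoms ((\<lambda>k. k \<otimes>\<^bsub>G\<^esub> g) ` K) x =
      space M \<inter> (\<Inter>k\<in>K. atom_pullback M (T g) (atom_pullback M (T k) (atom_of \<alpha>)) x)"
    by (simp add: atoms_def)
  also have "\<dots> = atom_pullback M (T g) (atoms K) x"
    unfolding atom_pullback_def[of M "T g"] atoms_def using T_space[OF g] by auto
  finally show ?thesis .
qed

definition h :: "'g set \<Rightarrow> real" where
  "h K = enn2real (cond_ent M N (atoms K))"

text \<open>Subadditivity over the elements of \<open>K\<close>, each of which contributes at most the entropy of \<open>\<alpha>\<close>.\<close>

lemma cond_ent_atoms_finite:
  assumes "K \<in> Fpow (carrier G)"
  shows "cond_ent M N (atoms K) < \<infinity>"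
proof -
  have "finite K" "K \<subseteq> carrier G" using assms by (auto simp: Fpow_def)
  then show ?thesis
  proof (induction K rule: finite_induct)
    case empty
    then show ?case by (simp add: atoms_empty cond_ent_space N_subalgebra)
  next
    case (insert g K)
    have am: "atom_map M (atoms {g})" "atom_map M (atoms K)"
      using insert by (auto intro: atom_map_atoms simp: Fpow_def)
    have "cond_ent M N (atoms {g}) = cond_ent M N (atom_pullback M (T g) (atom_of \<alpha>))"
      by (intro cond_ent_cong) (auto simp: atoms_def atom_pullback_def)
    also have "\<dots> \<le> cond_ent M N (atom_of \<alpha>)"
      using insert.prems by (intro cond_ent_pullback_le T_mp N_subalgebra T_measurable_N atom_map_partition[OF partition]) auto
    also have "\<dots> < \<infinity>" by (rule cond_ent_partition_finite[OF partition finite_entropy N_subalgebra])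
    finally have 1: "cond_ent M N (atoms {g}) < \<infinity>" .
    have "Conditional_Expectation.subalgebra N N" by (simp add: subalgebra_def)
    from cond_ent_submodular[OF N_subalgebra this am atom_map_space]
    have "cond_ent M N (atoms ({g} \<union> K \<union> {})) + cond_ent M N (atoms {}) \<le> cond_ent M N (atoms (K \<union> {})) + cond_ent M N (atoms ({g} \<union> {}))"
      unfolding atoms_Un atoms_empty .
    then have "cond_ent M N (atoms (insert g K)) \<le> cond_ent M N (atoms K) + cond_ent M N (atoms {g})"
      by (simp add: atoms_empty cond_ent_space N_subalgebra)
    also have "\<dots> < \<infinity>" using 1 insert by simp
    finally show ?case .
  qed
qed

lemma cond_ent_atoms: "K \<in> Fpow (carrier G) \<Longrightarrow> cond_ent M N (atoms K) = ennreal (h K)"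
  unfolding h_def using cond_ent_atoms_finite[of K] by simp

lemma h_ge_0 [simp]: "0 \<le> h K"
  by (simp add: h_def)

lemma shift_entropy_h:
  assumes "finite I" "\<And>i. i \<in> I \<Longrightarrow> s i \<in> carrier G"
  shows "shift_entropy G I s h"
proof (unfold_locales)
  have Un: "K \<union> L \<in> Fpow (carrier G)" if "K \<in> Fpow (carrier G)" "L \<in> Fpow (carrier G)" for K L
    using that by (auto simp: Fpow_def)
  show "h {} = 0" by (simp add: h_def atoms_empty cond_ent_space N_subalgebra)
  fix K L P assume L: "L \<in> Fpow (carrier G)"
  show "h K \<le> h L" if "K \<subseteq> L"
  proof -
    have K: "K \<in> Fpow (carrier G)" using L that by (auto simp: Fpow_def intro: finite_subset)
    have "cond_ent M N (atoms K) \<le> cond_ent M N (atoms L)"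
      by (rule cond_ent_mono[OF N_subalgebra atom_map_atoms[OF L] atom_map_atoms[OF K]]) (use that in \<open>auto simp: atoms_def\<close>)
    then show ?thesis by (simp add: cond_ent_atoms K L)
  qed
  assume K: "K \<in> Fpow (carrier G)"
  show "h (K \<union> L \<union> P) + h P \<le> h (K \<union> P) + h (L \<union> P)" if P: "P \<in> Fpow (carrier G)"
  proof -
    have "Conditional_Expectation.subalgebra N N" by (simp add: subalgebra_def)
    from cond_ent_submodular[OF N_subalgebra this atom_map_atoms[OF K] atom_map_atoms[OF L] atom_map_atoms[OF P]]
    have "cond_ent M N (atoms (K \<union> L \<union> P)) + cond_ent M N (atoms P) \<le> cond_ent M N (atoms (L \<union> P)) + cond_ent M N (atoms (K \<union> P))"
      unfolding atoms_Un .
    then show ?thesis by (simp add: cond_ent_atoms K L P Un add.commute flip: ennreal_plus)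
  qed
  fix i assume i: "i \<in> I"
  show "h ((\<lambda>g. g \<otimes>\<^bsub>G\<^esub> s i) ` (K \<union> L)) - h ((\<lambda>g. g \<otimes>\<^bsub>G\<^esub> s i) ` L) \<le> h (K \<union> L) - h L"
  proof -
    have si: "s i \<in> carrier G" by (rule assms(2)[OF i])
    let ?t = "\<lambda>K. (\<lambda>g. g \<otimes>\<^bsub>G\<^esub> s i) ` K"
    have t: "?t K \<in> Fpow (carrier G)" if "K \<in> Fpow (carrier G)" for K
      using that si by (auto simp: Fpow_def)
    have shift: "cond_ent M N (atom_pullback M (T (s i)) (atoms K)) = cond_ent M N (atoms (?t K))"
      if "K \<in> Fpow (carrier G)" for K
      using that si by (intro cond_ent_cong) (auto simp: atoms_translate Fpow_def)
    from cond_ent_pullback_submodular[OF T_mp[OF si] N_subalgebra T_measurable_N[OF si] atom_map_atoms[OF K] atom_map_atoms[OF L]]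
    have "cond_ent M N (atoms (?t (K \<union> L))) + cond_ent M N (atoms L) \<le> cond_ent M N (atoms (?t L)) + cond_ent M N (atoms (K \<union> L))"
      unfolding atoms_Un[symmetric] shift[OF L] shift[OF Un[OF K L]] .
    then have "h (?t (K \<union> L)) + h L \<le> h (?t L) + h (K \<union> L)"
      by (simp add: cond_ent_atoms t K L Un flip: ennreal_plus del: image_Un)
    then show ?thesis by simp
  qed
qed (use assms in auto)

lemma cond_entropy_H_atoms:
  assumes "describes M P (atoms K)" "K \<in> Fpow (carrier G)"
  shows "cond_entropy_H M P \<F> = ennreal (h K)"
  using cond_entropy_H_eq_cond_ent[OF assms(1) atom_map_atoms[OF assms(2)] N_subalgebra] cond_ent_atoms[OF assms(2)] by simp

lemma describes_ball_join:
  assumes "word_ball G S n \<in> Fpow (carrier G)"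
  shows "describes M (ball_join G S M T \<alpha> n) (atoms (word_ball G S n))"
  unfolding ball_join_def
  using assms describes_Join[of "word_ball G S n" M "\<lambda>g. pullback M (T g) \<alpha>" "\<lambda>g. atom_pullback M (T g) (atom_of \<alpha>)"]
    describes_pullback[OF describes_partition[OF partition]] T_space
  unfolding atoms_def Fpow_def by blast

context
  fixes r :: nat and s :: "nat \<Rightarrow> 'g"
  assumes s: "\<And>i. i \<in> {1..r} \<Longrightarrow> s i \<in> carrier G"
begin

interpretation shift_entropy G "{1..r}" s h
  using s by (intro shift_entropy_h) auto

lemma F_inv_eq:
  assumes P: "describes M P (atoms K)" and K: "K \<in> Fpow (carrier G)"
  shows "F_inv r s M T P \<F> = ereal (F K)"
proof -
  have "cond_entropy_H M (join P (pullback M (T (s i)) P)) \<F> = ennreal (h (K \<union> rtrans K (s i)))"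
    if i: "i \<in> {1..r}" for i
  proof (rule cond_entropy_H_atoms)
    have "describes M (join P (pullback M (T (s i)) P)) (\<lambda>x. atoms K x \<inter> atom_pullback M (T (s i)) (atoms K) x)"
      using T_space s[OF i] by (intro describes_join describes_pullback P) auto
    then show "describes M (join P (pullback M (T (s i)) P)) (atoms (K \<union> rtrans K (s i)))"
      by (rule describes_cong)
        (use K s[OF i] in \<open>auto simp: atoms_Un rtrans_def atoms_translate Fpow_def\<close>)
    show "K \<union> rtrans K (s i) \<in> Fpow (carrier G)"
      using K s[OF i] by simp
  qed
  then have "F_inv r s M T P \<F> = ereal (1 - 2 * real r) * ereal (h K) + (\<Sum>i=1..r. ereal (h (K \<union> rtrans K (s i))))"
    unfolding F_inv_def cond_entropy_H_atoms[OF P K] by (simp add: enn2ereal_ennreal)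
  then show ?thesis unfolding F_def by simp
qed

lemma entropy_rate_eq:
  assumes P: "describes M P (atoms K)" and K: "K \<in> Fpow (carrier G)" and i: "i \<in> {1..r}"
  shows "entropy_rate M (T (s i)) P \<F> = ennreal (rate i K)"
proof -
  have "cond_entropy_H M (Join M {0..n} (\<lambda>j. pullback M (T (s i) ^^ j) P)) \<F> = ennreal (h (chain i K n))" for n
  proof (rule cond_entropy_H_atoms)
    \<comment> \<open>the iterates of \<open>T (s i)\<close> agree with the action of the powers only on the space\<close>
    have eq: "pullback M (T (s i) ^^ j) P = pullback M (T (s i [^]\<^bsub>G\<^esub> j)) P" for j :: nat
      unfolding pullback_def using T_pow[OF s[OF i]] by (intro image_cong refl) (auto simp del: funpow.simps)
    have "describes M (Join M {0..n} (\<lambda>j. pullback M (T (s i) ^^ j) P))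
      (\<lambda>x. space M \<inter> (\<Inter>j\<in>{0..n}. atom_pullback M (T (s i [^]\<^bsub>G\<^esub> j)) (atoms K) x))"
      unfolding eq using s[OF i] T_space by (intro describes_Join describes_pullback P) auto
    moreover have "space M \<inter> (\<Inter>j\<in>{0..n}. atom_pullback M (T (s i [^]\<^bsub>G\<^esub> j)) (atoms K) x) = atoms (chain i K n) x"
      if x: "x \<in> space M" for x
    proof -
      have "atom_pullback M (T (s i [^]\<^bsub>G\<^esub> j)) (atoms K) x = atoms (rtrans K (s i [^]\<^bsub>G\<^esub> j)) x" for j :: nat
        unfolding rtrans_def using K s[OF i] x by (intro atoms_translate[symmetric]) (auto simp: Fpow_def)
      then show ?thesis by (auto simp: chain_def atoms_def)
    qed
    ultimately show "describes M (Join M {0..n} (\<lambda>j. pullback M (T (s i) ^^ j) P)) (atoms (chain i K n))"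
      by (rule describes_cong)
    show "chain i K n \<in> Fpow (carrier G)" by (rule finsets_chain[OF i K])
  qed
  then have "cond_entropy_H M (Join M {0..n} (\<lambda>j. pullback M (T (s i) ^^ j) P)) \<F> / of_nat (n + 1) =
      ennreal (h (chain i K n) / real (n + 1))" for n
    by (simp only: ennreal_of_nat_eq_real_of_nat) (rule divide_ennreal; simp)
  then show ?thesis
    unfolding entropy_rate_def using tendsto_ennrealI[OF rate_LIMSEQ[OF i K]] by (simp only: limI)
qed

lemma rate_nonneg: "i \<in> {1..r} \<Longrightarrow> K \<in> Fpow (carrier G) \<Longrightarrow> 0 \<le> rate i K"
  by (rule LIMSEQ_le_const[OF rate_LIMSEQ]) auto

lemma F_star_inv_eq:
  assumes P: "describes M P (atoms K)" and K: "K \<in> Fpow (carrier G)"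
  shows "F_star_inv r s M T P \<F> = ereal (Fstar K)"
proof -
  have "(\<Sum>i=1..r. enn2ereal (entropy_rate M (T (s i)) P \<F>)) = (\<Sum>i=1..r. ereal (rate i K))"
    by (intro sum.cong refl) (simp only: entropy_rate_eq[OF P K] enn2ereal_ennreal[OF rate_nonneg[OF _ K]])
  then show ?thesis
    unfolding F_star_inv_def cond_entropy_H_atoms[OF P K] unfolding Fstar_def by (simp add: enn2ereal_ennreal)
qed

lemma f_star_inv_eq_f_inv:
  assumes S: "finite S" "S \<subseteq> carrier G"
    and gen: "\<And>u. u \<in> S \<Longrightarrow> \<exists>i\<in>{1..r}. u = s i \<or> u \<otimes>\<^bsub>G\<^esub> s i = \<one>\<^bsub>G\<^esub>"
    and exhaust: "carrier G \<subseteq> (\<Union>n. word_ball G S n)"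
  shows "f_star_inv G S r s M T \<alpha> \<F> = f_inv G S r s M T \<alpha> \<F>"
proof -
  note B = word_ball_finsets[OF S]
  have f: "f_inv G S r s M T \<alpha> \<F> = (INF n\<in>{0<..}. ereal (F (word_ball G S n)))"
    unfolding f_inv_def by (simp add: F_inv_eq[OF describes_ball_join[OF B] B])
  have fs: "f_star_inv G S r s M T \<alpha> \<F> = (INF n\<in>{0<..}. ereal (Fstar (word_ball G S n)))"
    unfolding f_star_inv_def by (simp add: F_star_inv_eq[OF describes_ball_join[OF B] B])
  have mono: "word_ball G S m \<subseteq> word_ball G S n" if "m \<le> n" for m n
    using that unfolding word_ball_def by (auto intro: order_trans)
  show ?thesis unfolding f fs
  proof (rule antisym)
    show "(INF n\<in>{0<..}. ereal (Fstar (word_ball G S n))) \<le> (INF n\<in>{0<..}. ereal (F (word_ball G S n)))"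
      using Fstar_le_F[OF B] by (intro INF_mono) auto
    show "(INF n\<in>{0<..}. ereal (F (word_ball G S n))) \<le> (INF n\<in>{0<..}. ereal (Fstar (word_ball G S n)))"
    proof (rule INF_greatest, rule ereal_le_epsilon2)
      fix n :: nat and e :: real assume "n \<in> {0<..}" "0 < e"
      then obtain L where L: "L \<in> Fpow (carrier G)" "word_ball G S n \<subseteq> L" "F L \<le> Fstar (word_ball G S n) + e"
        using exists_F_near_Fstar[OF B] by blast
      have "finite L" "L \<subseteq> (\<Union>n. word_ball G S n)" using L(1) exhaust by (auto simp: Fpow_def)
      then have "\<exists>m. L \<subseteq> word_ball G S m"
      proof (induction L rule: finite_induct)
        case (insert x L)
        then obtain m k where "L \<subseteq> word_ball G S m" "x \<in> word_ball G S k" by auto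
        then show ?case using mono[of m "max m k"] mono[of k "max m k"] by (intro exI[of _ "max m k"]) auto
      qed simp
      then obtain m where m: "L \<subseteq> word_ball G S m" ..
      then have m': "L \<subseteq> word_ball G S (Suc m)" using mono[of m "Suc m"] by auto
      have "F (word_ball G S (Suc m)) \<le> F L"
        using L one_in_word_ball m' by (intro F_word_ball_le S gen) auto
      then have "ereal (F (word_ball G S (Suc m))) \<le> ereal (Fstar (word_ball G S n)) + ereal e"
        using L(3) by simp
      then show "(INF n\<in>{0<..}. ereal (F (word_ball G S n))) \<le> ereal (Fstar (word_ball G S n)) + ereal e"
        by (rule INF_lower2[rotated]) simp
    qed
  qed
qed

end

end

section \<open>Equality of the two invariants\<close>

text \<open>The measurable sets form one of the invariant \<open>\<sigma>\<close>-algebras whose intersection is taken, so the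
  intersection consists of measurable sets.\<close>

lemma G_algebra_properties:
  assumes "meas_partition M \<beta>" "mp_action G M T"
  shows "sigma_algebra (space M) (G_algebra G M T \<beta>)" "G_algebra G M T \<beta> \<subseteq> sets M"
    "G_invariant G M T (G_algebra G M T \<beta>)"
proof -
  let ?FF = "{\<F>. sigma_algebra (space M) \<F> \<and> G_invariant G M T \<F> \<and> \<beta> \<subseteq> \<F>}"
  have "G_invariant G M T (sets M)"
    using assms(2) unfolding G_invariant_def mp_action_def measure_preserving_map_def
    by (blast intro: measurable_sets)
  then have M: "sets M \<in> ?FF"
    using assms(1) by (simp add: sets.sigma_algebra_axioms meas_partition_def)
  then show sub: "G_algebra G M T \<beta> \<subseteq> sets M" unfolding G_algebra_def by blast
  show "G_invariant G M T (G_algebra G M T \<beta>)"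
    unfolding G_algebra_def G_invariant_def by blast
  have sa: "sigma_algebra (space M) \<F>" if "\<F> \<in> ?FF" for \<F> using that by simp
  show "sigma_algebra (space M) (G_algebra G M T \<beta>)"
    unfolding sigma_algebra_iff2
  proof (intro conjI ballI allI impI)
    show "G_algebra G M T \<beta> \<subseteq> Pow (space M)" using sub sets.space_closed by blast
    show "{} \<in> G_algebra G M T \<beta>"
      unfolding G_algebra_def using sa by (auto simp: sigma_algebra_iff2)
    show "space M - E \<in> G_algebra G M T \<beta>" if "E \<in> G_algebra G M T \<beta>" for E
      using that sa unfolding G_algebra_def sigma_algebra_iff2 by blast
    show "(\<Union>i. E i) \<in> G_algebra G M T \<beta>" if "range E \<subseteq> G_algebra G M T \<beta>" for E :: "nat \<Rightarrow> _"
      unfolding G_algebra_def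
    proof
      fix \<F> assume \<F>: "\<F> \<in> ?FF"
      then have "range E \<subseteq> \<F>" using that unfolding G_algebra_def by blast
      then show "(\<Union>i. E i) \<in> \<F>" using sa[OF \<F>] by (simp add: sigma_algebra_iff2)
    qed
  qed
qed


lemma free_group_carrier_word_ball:
  assumes free: "free_group_on G r s" and S: "S = s ` {1..r} \<union> (\<lambda>i. m_inv G (s i)) ` {1..r}"
  shows "carrier G \<subseteq> (\<Union>n. word_ball G S n)"
proof
  fix x assume "x \<in> carrier G"
  then obtain w where w: "w \<in> reduced_words r" "x = word_prod G (map (letter G s) w)"
    using free unfolding free_group_on_def bij_betw_def by blast
  have "letter G s l \<in> S" if "l \<in> set w" for l
    using w(1) that by (auto simp: reduced_words_def letter_def S)
  then have "x \<in> word_ball G S (length w)"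
    unfolding word_ball_def w(2) by (intro CollectI exI[of _ "map (letter G s) w"]) auto
  then show "x \<in> (\<Union>n. word_ball G S n)" by blast
qed

lemma free_monoid_carrier_word_ball:
  assumes free: "free_monoid_on G r s" and S: "S = s ` {1..r}"
  shows "carrier G \<subseteq> (\<Union>n. word_ball G S n)"
proof
  fix x assume "x \<in> carrier G"
  then obtain w where w: "w \<in> lists {1..r}" "x = word_prod G (map s w)"
    using free unfolding free_monoid_on_def bij_betw_def by blast
  then have "x \<in> word_ball G S (length w)"
    unfolding word_ball_def w(2) by (intro CollectI exI[of _ "map s w"]) (auto simp: S)
  then show "x \<in> (\<Union>n. word_ball G S n)" by blast
qed

theorem theorem9p1:
  fixes G :: "('g, 'b) monoid_scheme" and r :: nat and s :: "nat \<Rightarrow> 'g" and S :: "'g set"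
    and M :: "'a measure" and T :: "'g \<Rightarrow> 'a \<Rightarrow> 'a" and \<alpha> \<beta> :: "'a set set"
  assumes "(free_group_on G r s \<and> S = s ` {1..r} \<union> (\<lambda>i. m_inv G (s i)) ` {1..r}) \<or>
           (free_monoid_on G r s \<and> S = s ` {1..r})"
    and "standard_prob_space M"
    and "mp_action G M T"
    and "meas_partition M \<alpha>" and "entropy_H M \<alpha> < \<infinity>"
    and "meas_partition M \<beta>" and "entropy_H M \<beta> < \<infinity>"
    and "G_algebra G M T \<beta> \<subseteq> G_algebra G M T \<alpha>"
  shows "f_star_inv G S r s M T \<alpha> (G_algebra G M T \<beta>) = f_inv G S r s M T \<alpha> (G_algebra G M T \<beta>)"
proof -
  have G: "monoid G" and s: "s ` {1..r} \<subseteq> carrier G"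
    using assms(1) by (auto simp: free_group_on_def free_monoid_on_def group_def)
  have gen: "finite S \<and> S \<subseteq> carrier G \<and> (\<forall>u\<in>S. \<exists>i\<in>{1..r}. u = s i \<or> u \<otimes>\<^bsub>G\<^esub> s i = \<one>\<^bsub>G\<^esub>) \<and>
      carrier G \<subseteq> (\<Union>n. word_ball G S n)"
    using assms(1)
  proof
    assume *: "free_group_on G r s \<and> S = s ` {1..r} \<union> (\<lambda>i. m_inv G (s i)) ` {1..r}"
    then interpret group G by (simp add: free_group_on_def)
    have closed: "s i \<in> carrier G" if "i \<in> {1..r}" for i using s that by blast
    have "\<exists>i\<in>{1..r}. u = s i \<or> u \<otimes>\<^bsub>G\<^esub> s i = \<one>\<^bsub>G\<^esub>" if "u \<in> S" for u
    proof -
      from * that consider i where "i \<in> {1..r}" "u = s i" | i where "i \<in> {1..r}" "u = m_inv G (s i)"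
        by auto
      then show ?thesis by cases (use closed in \<open>auto intro!: bexI simp del: atLeastAtMost_iff One_nat_def\<close>)
    qed
    moreover have "finite S" "S \<subseteq> carrier G" using * closed by auto
    moreover have "carrier G \<subseteq> (\<Union>n. word_ball G S n)"
      using * by (intro free_group_carrier_word_ball) simp_all
    ultimately show ?thesis by simp
  next
    assume *: "free_monoid_on G r s \<and> S = s ` {1..r}"
    then have "carrier G \<subseteq> (\<Union>n. word_ball G S n)"
      by (intro free_monoid_carrier_word_ball) simp_all
    with * s show ?thesis by auto
  qed
  interpret monoid G by (rule G)
  interpret prob_space M using assms(2) by (simp add: standard_prob_space_def)
  interpret mp_monoid_action M G T \<alpha> "G_algebra G M T \<beta>"
    by (rule mp_monoid_action.intro[OF prob_space_axioms monoid_axioms mp_monoid_action_axioms.intro])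
      (rule assms(3-5) G_algebra_properties[OF assms(6,3)])+
  show ?thesis
  proof (rule f_star_inv_eq_f_inv)
    show "s i \<in> carrier G" if "i \<in> {1..r}" for i using s that by blast
    show "\<exists>i\<in>{1..r}. u = s i \<or> u \<otimes>\<^bsub>G\<^esub> s i = \<one>\<^bsub>G\<^esub>" if "u \<in> S" for u
      using gen that by blast
  qed (use gen in \<open>simp_all only: simp_thms\<close>)
qed
end
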